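(* Let $V^{n}$ be a Riemannian space with line element $$ds^{2}=du^{2}+h_{ij}(u,x^{k})\,dx^{i}dx^{j},\qquad i,j=1,\dots,n-1,$$ and let $\lambda$ be a constant. Consider the Lagrangian of the minimal surface $u=u(x^{k})$ enclosing a constant volume, $$L=\sqrt{|h|+|h|h^{ij}u_{,i}u_{,j}}+\lambda\int\sqrt{|h|}\,du .$$ Then the Noether point symmetries of $L$ are the Killing vector fields $$\mathbf{X}=\xi^{i}(x^{k},u)\,\partial_{i}+\eta(x^{k})\,\partial_{u}$$ of the space $V^{n}$, provided there exists a vector field $A^{i}(u,x^{k})$ given by the expression $$A^{k}=\lambda\int\left(\int\sqrt{|h|}\,du\right)\xi^{k}_{,u}\,du+\Phi^{k}(x^{1},\dots,x^{n-1}),$$ where $\Phi^{k}$, a function of $x^{1},\dots,x^{n-1}$ only, satisfies $$\Phi^{k}_{,k}=\lambda\left(\xi^{k}\int\sqrt{|h|}\,du\right)_{,k}+\lambda\sqrt{|h|}\,\eta-\lambda\left[\int\left(\int\sqrt{|h|}\,du\right)\xi^{k}_{,u}\,du\right]_{,k}.$$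
   Context: Indices $i,j,k$ run over $1,\dots,n-1$ and repeated indices are summed. $|h|$ is the absolute value of the determinant of $(h_{ij})$, and $h^{ij}$ is the inverse matrix. A comma denotes a partial derivative: $f_{,k}=\partial f/\partial x^{k}$ and $f_{,u}=\partial f/\partial u$ for functions $f(x^{k},u)$ (so $x$ and $u$ are treated as independent); for the surface $u=u(x^{k})$, $u_{,i}=u_{i}$ denotes the first derivative of the dependent variable $u$, and $u_{ij}$ its second derivatives. The symbols $\int(\cdot)\,du$ denote antiderivatives in $u$ at fixed $x^{k}$, the same choices being used throughout. The independent variables are $x^{1},\dots,x^{n-1}$ and the dependent variable is $u$. For $\mathbf{X}=\xi^{i}(x^{k},u)\partial_{x^{i}}+\eta(x^{k},u)\partial_{u}$ the first prolongation is $\mathbf{X}^{[1]}=\mathbf{X}+\eta_{i}\,\partial_{u_{i}}$ with $\eta_{i}=\eta_{,i}+u_{i}\eta_{,u}-\xi^{j}_{,i}u_{j}-u_{i}u_{j}\xi^{j}_{,u}$. The total derivative is $D_{i}=\partial_{x^{i}}+u_{i}\partial_{u}+u_{ij}\partial_{u_{j}}+\cdots$. $\mathbf{X}$ is a Noether point symmetry of $L=L(x^{k},u,u_{k})$ if there exists a vector field $A^{i}=A^{i}(x^{k},u)$ (the Noether gauge vector) such that $$\mathbf{X}^{[1]}L+L\,D_{i}\xi^{i}=D_{i}A^{i}$$ identically in $x^{k},u,u_{k}$. The vector field $A^{i}$ in the claim is this gauge vector. Killing vector fields of $V^{n}$ are the vector fields $\mathbf{X}$ with $\mathcal{L}_{\mathbf{X}}g=0$,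 where $g$ is the $n$-dimensional metric $ds^{2}$ and $(x^{k},u)$ are its coordinates. *)

theory Defs
  imports "HOL-Analysis.Analysis"
begin

text \<open>
  The coordinates \<open>(x, u)\<close> of the \<open>n\<close>-dimensional space are points of \<open>(real ^ 'm) \<times> real\<close>,
  where \<open>CARD('m) = n - 1\<close>; in particular \<open>n \<ge> 2\<close>.  Points of the first jet space
  are pairs \<open>((x, u), p)\<close>, where the component \<open>p $ i\<close> plays the role of the derivative \<open>u\<^sub>i\<close>.
\<close>

definition partial_along :: "'a::real_normed_vector \<Rightarrow> ('a \<Rightarrow> real) \<Rightarrow> 'a \<Rightarrow> real" where
  "partial_along b f z = deriv (\<lambda>t. f (z + t *\<^sub>R b)) 0"

definition px :: "'m::finite \<Rightarrow> ((real ^ 'm) \<times> real \<Rightarrow> real) \<Rightarrow> (real ^ 'm) \<times> real \<Rightarrow> real" where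
  "px k = partial_along (axis k 1, 0)"

definition pu :: "((real ^ 'm::finite) \<times> real \<Rightarrow> real) \<Rightarrow> (real ^ 'm) \<times> real \<Rightarrow> real" where
  "pu = partial_along (0, 1)"

text \<open>
  Total derivative \<open>D\<^sub>i\<close> of a function of \<open>(x, u)\<close> alone, for which the terms in the
  derivatives of \<open>u\<close> of order two and higher are absent.
\<close>

definition total_deriv ::
    "'m::finite \<Rightarrow> ((real ^ 'm) \<times> real \<Rightarrow> real) \<Rightarrow> ((real ^ 'm) \<times> real) \<times> (real ^ 'm) \<Rightarrow> real" where
  "total_deriv i f = (\<lambda>(z, p). px i f z + p $ i * pu f z)"

definition prolongation_coeff ::
    "((real ^ 'm::finite) \<times> real \<Rightarrow> real ^ 'm) \<Rightarrow> ((real ^ 'm) \<times> real \<Rightarrow> real) \<Rightarrow> 'm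
      \<Rightarrow> ((real ^ 'm) \<times> real) \<times> (real ^ 'm) \<Rightarrow> real" where
  "prolongation_coeff \<xi> \<eta> i = (\<lambda>(z, p).
     px i \<eta> z + p $ i * pu \<eta> z
     - (\<Sum>j\<in>UNIV. px i (\<lambda>y. \<xi> y $ j) z * p $ j)
     - (\<Sum>j\<in>UNIV. p $ i * p $ j * pu (\<lambda>y. \<xi> y $ j) z))"

definition first_prolongation ::
    "((real ^ 'm::finite) \<times> real \<Rightarrow> real ^ 'm) \<Rightarrow> ((real ^ 'm) \<times> real \<Rightarrow> real)
      \<Rightarrow> (((real ^ 'm) \<times> real) \<times> (real ^ 'm) \<Rightarrow> real)
      \<Rightarrow> ((real ^ 'm) \<times> real) \<times> (real ^ 'm) \<Rightarrow> real" where
  "first_prolongation \<xi> \<eta> L = (\<lambda>(z, p).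
     (\<Sum>i\<in>UNIV. \<xi> z $ i * partial_along ((axis i 1, 0), 0) L (z, p))
     + \<eta> z * partial_along ((0, 1), 0) L (z, p)
     + (\<Sum>i\<in>UNIV. prolongation_coeff \<xi> \<eta> i (z, p) * partial_along ((0, 0), axis i 1) L (z, p)))"

definition noether_gauge_vector ::
    "((real ^ 'm::finite) \<times> real) set
      \<Rightarrow> (((real ^ 'm) \<times> real) \<times> (real ^ 'm) \<Rightarrow> real)
      \<Rightarrow> ((real ^ 'm) \<times> real \<Rightarrow> real ^ 'm) \<Rightarrow> ((real ^ 'm) \<times> real \<Rightarrow> real)
      \<Rightarrow> ((real ^ 'm) \<times> real \<Rightarrow> real ^ 'm) \<Rightarrow> bool" where
  "noether_gauge_vector U L \<xi> \<eta> A \<longleftrightarrow>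
     A differentiable_on U \<and>
     (\<forall>z\<in>U. \<forall>p.
        first_prolongation \<xi> \<eta> L (z, p)
          + L (z, p) * (\<Sum>i\<in>UNIV. total_deriv i (\<lambda>y. \<xi> y $ i) (z, p))
        = (\<Sum>i\<in>UNIV. total_deriv i (\<lambda>y. A y $ i) (z, p)))"

definition noether_point_symmetry ::
    "((real ^ 'm::finite) \<times> real) set
      \<Rightarrow> (((real ^ 'm) \<times> real) \<times> (real ^ 'm) \<Rightarrow> real)
      \<Rightarrow> ((real ^ 'm) \<times> real \<Rightarrow> real ^ 'm) \<Rightarrow> ((real ^ 'm) \<times> real \<Rightarrow> real) \<Rightarrow> bool" where
  "noether_point_symmetry U L \<xi> \<eta> \<longleftrightarrow> (\<exists>A. noether_gauge_vector U L \<xi> \<eta> A)"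

text \<open>Only first derivatives of the metric enter, so no more than differentiability is required.\<close>

definition riemannian_metric_on ::
    "'a::euclidean_space set \<Rightarrow> ('a \<Rightarrow> 'a \<Rightarrow> 'a \<Rightarrow> real) \<Rightarrow> bool" where
  "riemannian_metric_on U g \<longleftrightarrow>
     (\<forall>v w. (\<lambda>z. g z v w) differentiable_on U) \<and>
     (\<forall>z\<in>U. bilinear (g z) \<and> (\<forall>v w. g z v w = g z w v) \<and> (\<forall>v. v \<noteq> 0 \<longrightarrow> g z v v > 0))"

text \<open>
  On basis vectors this is the coordinate formula
  \<open>X\<^sup>c \<partial>\<^sub>c g\<^sub>a\<^sub>b + g\<^sub>c\<^sub>b \<partial>\<^sub>a X\<^sup>c + g\<^sub>a\<^sub>c \<partial>\<^sub>b X\<^sup>c\<close>.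
\<close>

definition lie_derivative_metric ::
    "('a::euclidean_space \<Rightarrow> 'a) \<Rightarrow> ('a \<Rightarrow> 'a \<Rightarrow> 'a \<Rightarrow> real) \<Rightarrow> 'a \<Rightarrow> 'a \<Rightarrow> 'a \<Rightarrow> real" where
  "lie_derivative_metric X g z v w =
     frechet_derivative (\<lambda>y. g y v w) (at z) (X z)
     + g z (frechet_derivative X (at z) v) w
     + g z v (frechet_derivative X (at z) w)"

definition killing_vector_field ::
    "'a::euclidean_space set \<Rightarrow> ('a \<Rightarrow> 'a \<Rightarrow> 'a \<Rightarrow> real) \<Rightarrow> ('a \<Rightarrow> 'a) \<Rightarrow> bool" where
  "killing_vector_field U g X \<longleftrightarrow>
     X differentiable_on U \<and> (\<forall>z\<in>U. \<forall>v w. lie_derivative_metric X g z v w = 0)"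

text \<open>The line element \<open>du\<^sup>2 + h\<^sub>i\<^sub>j(u, x) dx\<^sup>i dx\<^sup>j\<close> as a bilinear form.\<close>

definition line_element ::
    "((real ^ 'm::finite) \<times> real \<Rightarrow> real ^ 'm ^ 'm) \<Rightarrow> (real ^ 'm) \<times> real
      \<Rightarrow> (real ^ 'm) \<times> real \<Rightarrow> (real ^ 'm) \<times> real \<Rightarrow> real" where
  "line_element h z v w =
     snd v * snd w + (\<Sum>i\<in>UNIV. \<Sum>j\<in>UNIV. h z $ i $ j * fst v $ i * fst w $ j)"

text \<open>An antiderivative of \<open>f\<close> in \<open>u\<close> at fixed \<open>x\<close>; the integration ``constant'' is an
  arbitrary differentiable function of \<open>x\<close>.\<close>

definition u_antiderivative ::
    "((real ^ 'm::finite) \<times> real) set \<Rightarrow> ((real ^ 'm) \<times> real \<Rightarrow> real)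
      \<Rightarrow> ((real ^ 'm) \<times> real \<Rightarrow> real) \<Rightarrow> bool" where
  "u_antiderivative U f F \<longleftrightarrow>
     F differentiable_on U \<and>
     (\<forall>(x, u)\<in>U. ((\<lambda>s. F (x, s)) has_real_derivative f (x, u)) (at u))"

text \<open>The argument \<open>F\<close> is the chosen antiderivative \<open>\<integral> \<surd>\<bar>h\<bar> du\<close>.\<close>

definition minimal_surface_lagrangian ::
    "((real ^ 'm::finite) \<times> real \<Rightarrow> real ^ 'm ^ 'm) \<Rightarrow> real \<Rightarrow> ((real ^ 'm) \<times> real \<Rightarrow> real)
      \<Rightarrow> ((real ^ 'm) \<times> real) \<times> (real ^ 'm) \<Rightarrow> real" where
  "minimal_surface_lagrangian h lam F = (\<lambda>(z, p).
     sqrt (\<bar>det (h z)\<bar>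
           + \<bar>det (h z)\<bar> * (\<Sum>i\<in>UNIV. \<Sum>j\<in>UNIV. matrix_inv (h z) $ i $ j * p $ i * p $ j))
     + lam * F z)"

text \<open>
  Here \<open>F\<close> is the chosen \<open>\<integral> \<surd>\<bar>h\<bar> du\<close> and \<open>G z $ k\<close> the chosen \<open>\<integral> F \<xi>\<^sup>k\<^sub>,\<^sub>u du\<close>.  The function
  \<open>\<Phi>\<close> depends on \<open>x\<close> only, so its divergence must equal the right-hand side
  at every \<open>u\<close>.
\<close>

definition prescribed_gauge ::
    "((real ^ 'm::finite) \<times> real) set \<Rightarrow> ((real ^ 'm) \<times> real \<Rightarrow> real ^ 'm ^ 'm) \<Rightarrow> real
      \<Rightarrow> ((real ^ 'm) \<times> real \<Rightarrow> real) \<Rightarrow> ((real ^ 'm) \<times> real \<Rightarrow> real ^ 'm)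
      \<Rightarrow> ((real ^ 'm) \<times> real \<Rightarrow> real ^ 'm) \<Rightarrow> ((real ^ 'm) \<times> real \<Rightarrow> real)
      \<Rightarrow> ((real ^ 'm) \<times> real \<Rightarrow> real ^ 'm) \<Rightarrow> bool" where
  "prescribed_gauge U h lam F G \<xi> \<eta> A \<longleftrightarrow>
     (\<exists>\<Phi> :: real ^ 'm \<Rightarrow> real ^ 'm.
        \<Phi> differentiable_on (fst ` U) \<and>
        (\<forall>(x, u)\<in>U. \<forall>k. A (x, u) $ k = lam * G (x, u) $ k + \<Phi> x $ k) \<and>
        (\<forall>(x, u)\<in>U.
           (\<Sum>k\<in>UNIV. partial_along (axis k 1) (\<lambda>y. \<Phi> y $ k) x)
           = lam * (\<Sum>k\<in>UNIV. px k (\<lambda>z. \<xi> z $ k * F z) (x, u))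
             + lam * sqrt \<bar>det (h (x, u))\<bar> * \<eta> (x, u)
             - lam * (\<Sum>k\<in>UNIV. px k (\<lambda>z. G z $ k) (x, u))))"

end

theory Submission
  imports Defs
begin

text \<open>
  Fix a point \<open>z = (x, u)\<close> and write \<open>p = h y\<close>, \<open>Q = h(y, y)\<close>.  Multiplied by \<open>\<surd>(1 + Q)\<close>, the Noether
  identity takes the form \<open>P = \<surd>(1 + Q) R\<close>, where \<open>P\<close> is a polynomial of degree two in \<open>y\<close> (its cubic
  terms cancel) and \<open>R\<close> is affine in \<open>y\<close>.  As \<open>\<surd>(1 + Q)\<close> is irrational along every line
  through the origin, both sides vanish identically.

  The coefficients of \<open>R\<close> give \<open>A\<^sup>k\<^sub>,\<^sub>u = \<lambda> F \<xi>\<^sup>k\<^sub>,\<^sub>u\<close> and the divergence condition on \<open>\<Phi>\<close>.  The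
  coefficients of \<open>P\<close> are the Killing equations, except that the quadratic ones read
  \<open>(\<L>\<^sub>X g)\<^sub>i\<^sub>j = 2 \<eta>\<^sub>,\<^sub>u h\<^sub>i\<^sub>j\<close>; their trace, compared with the constant coefficient of \<open>P\<close>, gives
  \<open>(n - 1) \<eta>\<^sub>,\<^sub>u = 0\<close>.
\<close>

subsection \<open>Matrix calculus\<close>

lemma matrix_inv_right:
  fixes A :: "'a::semiring_1^'n^'n"
  assumes "invertible A"
  shows "A ** matrix_inv A = mat 1"
  using assms unfolding invertible_def matrix_inv_def by (metis (mono_tags, lifting) someI_ex)

lemma matrix_inv_left:
  fixes A :: "'a::semiring_1^'n^'n"
  assumes "invertible A"
  shows "matrix_inv A ** A = mat 1"
  using assms unfolding invertible_def matrix_inv_def by (metis (mono_tags, lifting) someI_ex)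

lemma differentiable_vec_nth_iff:
  fixes f :: "'a::real_normed_vector \<Rightarrow> 'b::euclidean_space^'n"
  shows "f differentiable (at x within S) \<longleftrightarrow> (\<forall>i. (\<lambda>x. f x $ i) differentiable (at x within S))"
proof
  assume "\<forall>i. (\<lambda>x. f x $ i) differentiable (at x within S)"
  then have "\<forall>i. \<exists>D. ((\<lambda>x. f x $ i) has_derivative D) (at x within S)"
    by (simp add: differentiable_def)
  then obtain D where D: "\<And>i. ((\<lambda>x. f x $ i) has_derivative D i) (at x within S)"
    by metis
  have "(f has_derivative (\<lambda>h. \<chi> i. D i h)) (at x within S)"
    unfolding has_derivative_componentwise_within[of f]
    using D by (auto simp: Basis_vec_def inner_axis intro!: has_derivative_inner_left)
  then show "f differentiable (at x within S)"
    unfolding differentiable_def by blast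
qed (auto simp: differentiable_def intro: bounded_linear.has_derivative[OF bounded_linear_vec_nth])

text \<open>Product rule in the Leibniz formula: differentiating the factor from row
  \<open>i\<close> gives the determinant in which that row is replaced by the row of
  \<open>M\<close>. Invertibility is not assumed, so the rule also applies to the possibly singular
  numerator matrices of Cramer's rule.\<close>

lemma has_derivative_det_rows:
  fixes A :: "real^'n^'n"
  shows "(det has_derivative (\<lambda>M. \<Sum>i\<in>UNIV. det (\<chi> k. if k = i then M $ i else A $ k))) (at A)"
proof -
  let ?P = "{p. p permutes (UNIV :: 'n set)}"
  have rows: "det (\<chi> k. if k = i then M $ i else A $ k)
      = (\<Sum>p\<in>?P. of_int (sign p) * (M $ i $ p i * (\<Prod>j\<in>UNIV - {i}. A $ j $ p j)))"
    for M :: "real^'n^'n" and i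
    unfolding det_def
    by (intro sum.cong refl arg_cong2[where f="(*)"])
      (subst prod.remove[of _ i], auto intro!: prod.cong)
  have "((\<lambda>B. \<Sum>p\<in>?P. of_int (sign p) * (\<Prod>i\<in>UNIV. B $ i $ p i)) has_derivative
      (\<lambda>M. \<Sum>p\<in>?P. of_int (sign p) * (\<Sum>i\<in>UNIV. M $ i $ p i * (\<Prod>j\<in>UNIV - {i}. A $ j $ p j)))) (at A)"
    by (intro has_derivative_sum has_derivative_mult_right has_derivative_prod
        bounded_linear_imp_has_derivative bounded_linear_compose[OF bounded_linear_vec_nth bounded_linear_vec_nth])
  moreover have "(\<Sum>p\<in>?P. of_int (sign p) * (\<Sum>i\<in>UNIV. M $ i $ p i * (\<Prod>j\<in>UNIV - {i}. A $ j $ p j)))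
      = (\<Sum>i\<in>UNIV. det (\<chi> k. if k = i then M $ i else A $ k))" for M :: "real^'n^'n"
    unfolding rows by (subst sum.swap) (simp add: sum_distrib_left)
  ultimately show ?thesis
    by (simp add: det_def[abs_def])
qed

text \<open>Jacobi's formula. Writing \<open>M = (M ** matrix_inv A) ** A\<close> presents row
  \<open>i\<close> of \<open>M\<close> as a combination of the rows of \<open>A\<close>. After the
  replacement only the coefficient of row \<open>i\<close> itself survives; it is a diagonal entry,
  and these entries add up to a trace.\<close>

lemma has_derivative_det:
  fixes A :: "real^'n^'n"
  assumes "invertible A"
  shows "(det has_derivative (\<lambda>M. det A * trace (matrix_inv A ** M))) (at A)"
proof -
  have "det (\<chi> k. if k = i then M $ i else A $ k) = (M ** matrix_inv A) $ i $ i * det A"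
    for M :: "real^'n^'n" and i
  proof -
    have "M = (M ** matrix_inv A) ** A"
      using assms by (simp add: matrix_inv_left flip: matrix_mul_assoc)
    then have "M $ i = ((M ** matrix_inv A) ** A) $ i"
      by simp
    also have "\<dots> = (\<Sum>j\<in>UNIV. (M ** matrix_inv A) $ i $ j *s row j A)"
      by (simp add: vec_eq_iff matrix_matrix_mult_def[of "M ** matrix_inv A"] row_def)
    finally show ?thesis
      using cramer_lemma_transpose[of i "(M ** matrix_inv A) $ i" A]
      by (simp add: row_def cong: if_cong)
  qed
  then have "(\<Sum>i\<in>UNIV. det (\<chi> k. if k = i then M $ i else A $ k)) = det A * trace (matrix_inv A ** M)"
    for M :: "real^'n^'n"
    by (subst trace_mul_sym) (simp add: trace_def sum_distrib_left mult.commute)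
  then show ?thesis
    using has_derivative_det_rows[of A] by simp
qed

lemma bounded_bilinear_matrix_matrix_mult:
  "bounded_bilinear ((**) :: real^'n^'m \<Rightarrow> real^'k^'n \<Rightarrow> real^'k^'m)"
  unfolding bilinear_conv_bounded_bilinear[symmetric] bilinear_def
  by (auto intro!: linearI simp: matrix_add_ldistrib matrix_matrix_mult_def vec_eq_iff
      sum_distrib_left sum.distrib algebra_simps)

lemma bounded_bilinear_matrix_vector_mult:
  "bounded_bilinear ((*v) :: real^'n^'m \<Rightarrow> real^'n \<Rightarrow> real^'m)"
  unfolding bilinear_conv_bounded_bilinear[symmetric] bilinear_def
  by (auto intro!: linearI simp: matrix_vector_mult_def vec_eq_iff
      sum_distrib_left sum.distrib algebra_simps)

section \<open>Differentiation of the matrix inverse\<close>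

lemma eventually_invertible:
  fixes A :: "real^'n^'n"
  assumes "invertible A"
  shows "\<forall>\<^sub>F B in nhds A. invertible B"
proof -
  have "isCont det A"
    using has_derivative_continuous[OF has_derivative_det_rows] .
  moreover have "det A \<noteq> 0"
    using assms invertible_det_nz by blast
  ultimately have "\<forall>\<^sub>F B in nhds A. det B \<noteq> 0"
    by (metis continuous_within tendsto_imp_eventually_ne tendsto_at_iff_tendsto_nhds)
  then show ?thesis
    by (simp add: invertible_det_nz)
qed

text \<open>Cramer's rule makes every entry of the inverse a quotient of determinants. Only the
  existence of a derivative is extracted here; its value comes afterwards from the identity
  \<open>B ** matrix_inv B = mat 1\<close>.\<close>

lemma matrix_inv_differentiable:
  fixes A :: "real^'n^'n"
  assumes "invertible A"
  shows "matrix_inv differentiable (at A)"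
proof -
  let ?C = "\<lambda>B::real^'n^'n. \<chi> k l. det (\<chi> i j. if j = k then axis l 1 $ i else B $ i $ j) / det B"
  have inv: "matrix_inv B = ?C B" if "invertible B" for B :: "real^'n^'n"
  proof -
    have "B *v column l (matrix_inv B) = axis l 1" for l
      using that by (metis matrix_inv_right matrix_vector_mul_assoc matrix_vector_mul_lid matrix_vector_mult_basis)
    then have "column l (matrix_inv B) = (\<chi> k. det (\<chi> i j. if j = k then axis l 1 $ i else B $ i $ j) / det B)" for l
      using cramer[of B] that invertible_det_nz by blast
    then show ?thesis
      by (simp add: vec_eq_iff column_def)
  qed
  have num: "(\<lambda>B. det (\<chi> i j. if j = k then b $ i else B $ i $ j)) differentiable (at A)"
    for b :: "real^'n" and k
  proof (rule differentiable_compose[where f = det])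
    show "det differentiable at (\<chi> i j. if j = k then b $ i else A $ i $ j)"
      using has_derivative_det_rows by (meson differentiable_def)
    show "(\<lambda>B::real^'n^'n. \<chi> i j. if j = k then b $ i else B $ i $ j) differentiable at A"
      unfolding differentiable_vec_nth_iff
    proof (intro allI)
      fix i j
      show "(\<lambda>B::real^'n^'n. (\<chi> i j. if j = k then b $ i else B $ i $ j) $ i $ j) differentiable at A"
        by (cases "j = k") (auto intro!: bounded_linear_imp_differentiable
            bounded_linear_compose[OF bounded_linear_vec_nth bounded_linear_vec_nth])
    qed
  qed
  have "det A \<noteq> 0" "det differentiable (at A)"
    using assms invertible_det_nz has_derivative_det_rows by (auto simp: differentiable_def)
  then have "?C differentiable (at A)"
    using num by (auto simp: differentiable_vec_nth_iff intro!: differentiable_divide)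
  then obtain D where "(?C has_derivative D) (at A)"
    unfolding differentiable_def by blast
  \<comment> \<open>\<open>matrix_inv\<close> is an unspecified choice at singular matrices, so
    agreement with the quotient is claimed only near \<open>A\<close>, where invertibility
    persists.\<close>
  moreover have "\<forall>\<^sub>F B in at A. ?C B = matrix_inv B"
    using eventually_invertible[OF assms] inv by (auto simp: eventually_at_filter elim: eventually_mono)
  ultimately have "(matrix_inv has_derivative D) (at A)"
    by (rule has_derivative_transform_eventually) (use inv assms in auto)
  then show ?thesis
    unfolding differentiable_def by blast
qed

text \<open>Differentiating the locally constant product \<open>B ** matrix_inv B\<close> gives
  \<open>A ** D M + M ** matrix_inv A = 0\<close>, which is solved for \<open>D M\<close>.\<close>

lemma has_derivative_matrix_inv:
  fixes A :: "real^'n^'n"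
  assumes "invertible A"
  shows "(matrix_inv has_derivative (\<lambda>M. - (matrix_inv A ** M ** matrix_inv A))) (at A)"
proof -
  obtain D where D: "(matrix_inv has_derivative D) (at A)"
    using matrix_inv_differentiable[OF assms] unfolding differentiable_def by blast
  have "((\<lambda>B. B ** matrix_inv B) has_derivative (\<lambda>M. A ** D M + M ** matrix_inv A)) (at A)"
    by (rule bounded_bilinear.FDERIV[OF bounded_bilinear_matrix_matrix_mult has_derivative_ident D])
  moreover have "\<forall>\<^sub>F B in at A. B ** matrix_inv B = mat 1"
    using eventually_invertible[OF assms]
    by (auto simp: eventually_at_filter matrix_inv_right elim: eventually_mono)
  ultimately have "((\<lambda>B. mat 1 :: real^'n^'n) has_derivative (\<lambda>M. A ** D M + M ** matrix_inv A)) (at A)"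
    by (rule has_derivative_transform_eventually) (simp_all add: matrix_inv_right assms)
  then have "(\<lambda>M. A ** D M + M ** matrix_inv A) = (\<lambda>M. 0)"
    using has_derivative_const has_derivative_unique by blast
  then have "A ** D M = - (M ** matrix_inv A)" for M
    by (simp add: fun_eq_iff eq_neg_iff_add_eq_0)
  then have "matrix_inv A ** (A ** D M) = - (matrix_inv A ** M ** matrix_inv A)" for M
    by (metis bounded_bilinear.minus_right[OF bounded_bilinear_matrix_matrix_mult] matrix_mul_assoc)
  then have "D M = - (matrix_inv A ** M ** matrix_inv A)" for M
    by (simp add: matrix_mul_assoc matrix_inv_left assms)
  then have "D = (\<lambda>M. - (matrix_inv A ** M ** matrix_inv A))" by blast
  with D show ?thesis by simp
qed

subsection \<open>The determining equations at a point\<close>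

lemma inner_matrix_vector_mult_transpose:
  fixes A :: "real^'n^'m"
  shows "x \<bullet> (A *v y) = (transpose A *v x) \<bullet> y"
  by (simp add: dot_lmul_matrix transpose_matrix_vector)

lemma symmetric_matrix_inv:
  fixes A :: "real^'n^'n"
  assumes "invertible A" "transpose A = A"
  shows "transpose (matrix_inv A) = matrix_inv A"
proof -
  have "transpose (matrix_inv A) ** A = mat 1"
    using assms by (metis matrix_inv_right matrix_transpose_mul transpose_mat)
  then have "transpose (matrix_inv A) ** (A ** matrix_inv A) = mat 1 ** matrix_inv A"
    by (simp add: matrix_mul_assoc)
  then show ?thesis
    by (simp add: matrix_inv_right assms)
qed

lemma positive_definite_imp_invertible:
  fixes A :: "real^'n^'n"
  assumes "\<And>y. y \<noteq> 0 \<Longrightarrow> y \<bullet> (A *v y) > 0"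
  shows "invertible A"
proof -
  have "y = 0" if "A *v y = 0" for y
    using assms[of y] that by fastforce
  then show ?thesis
    by (metis invertible_left_inverse matrix_left_invertible_ker)
qed

text \<open>By polarization \<open>M\<close> is antisymmetric, and the trace pairing of a symmetric
  with an antisymmetric matrix equals its own negative. This allows an identity of quadratic forms
  to be traced against the inverse metric although the matrix representing the form need not be
  symmetric.\<close>

lemma trace_symmetric_mult_alternating:
  fixes K M :: "real^'n^'n"
  assumes "transpose K = K" and M: "\<And>y. y \<bullet> (M *v y) = 0"
  shows "trace (K ** M) = 0"
proof -
  have flip: "x \<bullet> (M *v y) = - (y \<bullet> (M *v x))" for x y
    using M[of "x + y"] M[of x] M[of y]
    by (simp add: matrix_vector_right_distrib inner_add_left inner_add_right)
  have "axis i 1 \<bullet> (M *v axis j 1) = M $ i $ j" for i j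
    by (simp add: inner_axis' matrix_vector_mult_basis column_def)
  then have anti: "M $ i $ j = - M $ j $ i" for i j
    using flip[of "axis i 1" "axis j 1"] by metis
  have sym: "K $ i $ j = K $ j $ i" for i j
    using arg_cong[OF assms(1), of "\<lambda>N. N $ j $ i"] by (simp add: transpose_def)
  have "trace (K ** M) = (\<Sum>i\<in>UNIV. \<Sum>j\<in>UNIV. K $ i $ j * M $ j $ i)"
    by (simp add: trace_def matrix_matrix_mult_def)
  also have "\<dots> = (\<Sum>j\<in>UNIV. \<Sum>i\<in>UNIV. K $ j $ i * - M $ i $ j)"
    by (subst sum.swap) (intro sum.cong refl, metis anti sym)
  also have "\<dots> = - trace (K ** M)"
    by (simp add: trace_def matrix_matrix_mult_def sum_negf)
  finally show ?thesis by simp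
qed

text \<open>Parity in \<open>t\<close> splits the identity into an even and an odd part. Squaring
  each removes the root, and the values at \<open>t = 1\<close> and \<open>t = 2\<close>, together
  with \<open>t = 0\<close> for \<open>c0\<close>, suffice to annihilate all coefficients.\<close>

lemma quadratic_eq_sqrt_mult_affine_imp_zero:
  fixes a b c0 c1 c2 q :: real
  assumes "q > 0" and eq: "\<And>t. c0 + c1 * t + c2 * t\<^sup>2 = sqrt (1 + q * t\<^sup>2) * (a + b * t)"
  shows "c0 = 0 \<and> c1 = 0 \<and> c2 = 0 \<and> a = 0 \<and> b = 0"
proof -
  let ?s = "\<lambda>t. sqrt (1 + q * t\<^sup>2)"
  have even: "c0 + c2 * t\<^sup>2 = ?s t * a" and odd: "c1 * t = ?s t * b * t" for t
  proof -
    have "c0 + c1 * t + c2 * t\<^sup>2 = ?s t * a + ?s t * b * t" "c0 - c1 * t + c2 * t\<^sup>2 = ?s t * a - ?s t * b * t"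
      using eq[of t] eq[of "-t"] by (simp_all add: algebra_simps)
    then show "c0 + c2 * t\<^sup>2 = ?s t * a" "c1 * t = ?s t * b * t"
      by linarith+
  qed
  have sq: "(?s t)\<^sup>2 = 1 + q * t\<^sup>2" for t
    using \<open>q > 0\<close> by simp
  have "c1\<^sup>2 = (1 + q) * b\<^sup>2" "c1\<^sup>2 = (1 + q * 4) * b\<^sup>2"
    using odd[of 1] odd[of 2] sq[of 1] sq[of 2] by (auto simp: power_mult_distrib)
  then have "3 * (q * b\<^sup>2) = 0"
    by (simp add: algebra_simps)
  then have b: "b = 0" and c1: "c1 = 0"
    using \<open>q > 0\<close> odd[of 1] by auto
  have c0: "c0 = a"
    using even[of 0] by simp
  have "(a + c2)\<^sup>2 = (1 + q) * a\<^sup>2" "(a + c2 * 4)\<^sup>2 = (1 + q * 4) * a\<^sup>2"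
    using even[of 1] even[of 2] sq[of 1] sq[of 2] c0 by (auto simp: power_mult_distrib)
  then have "2 * a * c2 + c2\<^sup>2 = q * a\<^sup>2" "8 * a * c2 + 16 * c2\<^sup>2 = 4 * (q * a\<^sup>2)"
    by (auto simp: power2_eq_square algebra_simps)
  \<comment> \<open>Subtracting four times the first equation from the second leaves
    \<open>12 * c2\<^sup>2 = 0\<close>.\<close>
  then have "c2\<^sup>2 = 0"
    by linarith
  with \<open>2 * a * c2 + c2\<^sup>2 = q * a\<^sup>2\<close> have "c2 = 0" "q * a\<^sup>2 = 0"
    by auto
  then show ?thesis
    using \<open>q > 0\<close> b c1 c0 by simp
qed

text \<open>The algebra at one point: \<open>H\<close> is the metric, \<open>H'\<close> its
  derivative along the field, \<open>B\<close> and \<open>w\<close> the \<open>x\<close>- and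
  \<open>u\<close>-derivatives of \<xi>, \<open>e\<close> and \<open>c\<close> those of \<eta>;
  \<open>a\<close> and \<open>b\<close> measure the failure of the gauge equations. \<open>T\<close>
  is absent on the right because the trace of the quadratic equations makes it a multiple of
  \<open>c\<close>.\<close>

lemma symmetry_determining_equations:
  fixes H H' B :: "real^'m^'m" and w e b :: "real^'m"
  defines "Q \<equiv> \<lambda>y. y \<bullet> (H *v y)" and "T \<equiv> trace (matrix_inv H ** H') / 2 + trace B"
  assumes sym: "transpose H = H" and pos: "\<And>y. y \<noteq> 0 \<Longrightarrow> y \<bullet> (H *v y) > 0" and "S > 0"
  shows "(\<forall>y. S * (T * (1 + Q y) + (H *v y) \<bullet> w + e \<bullet> y + Q y * c
              - y \<bullet> (H' *v y) / 2 - (H *v y) \<bullet> (B *v y))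
            = sqrt (1 + Q y) * (a + (H *v y) \<bullet> b))
      \<longleftrightarrow> (c = 0 \<and> (\<forall>y. e \<bullet> y + (H *v y) \<bullet> w = 0)
            \<and> (\<forall>y. y \<bullet> (H' *v y) / 2 + (H *v y) \<bullet> (B *v y) = 0)) \<and> a = 0 \<and> b = 0"
    (is "(\<forall>y. ?E y) \<longleftrightarrow> ?R")
proof -
  have inv: "invertible H"
    using pos by (rule positive_definite_imp_invertible)
  let ?N = "\<lambda>y. y \<bullet> (H' *v y) / 2 + (H *v y) \<bullet> (B *v y)"
  \<comment> \<open>Contraction of the quadratic equations with the inverse metric. It serves both
    directions: \<open>T = 0\<close> forces \<open>c = 0\<close> in the first, and
    \<open>c = 0\<close> forces \<open>T = 0\<close> in the second.\<close>
  have trace: "T = c * CARD('m)" if N: "\<And>y. ?N y = Q y * c" for c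
  proof -
    \<comment> \<open>\<open>M\<close> is assembled so that its quadratic form is
      \<open>?N y - Q y * c\<close>, while its trace against the inverse metric is the difference to
      be shown zero.\<close>
    define M where "M = (1 / 2) *\<^sub>R H' + H ** B - c *\<^sub>R H"
    have "y \<bullet> (M *v y) = ?N y - Q y * c" for y
      using sym
      by (simp add: M_def Q_def matrix_vector_mult_diff_rdistrib matrix_vector_mult_add_rdistrib
          inner_diff_right inner_add_right scaleR_matrix_vector_assoc[symmetric]
          inner_matrix_vector_mult_transpose[of y H] flip: matrix_vector_mul_assoc)
    then have "trace (matrix_inv H ** M) = 0"
      using N by (intro trace_symmetric_mult_alternating symmetric_matrix_inv inv sym) simp
    moreover have "trace (matrix_inv H ** M) = T - c * CARD('m)"
    proof -
      have "matrix_inv H ** M = (1 / 2) *\<^sub>R (matrix_inv H ** H') + matrix_inv H ** H ** B - c *\<^sub>R (matrix_inv H ** H)"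
        unfolding M_def
        by (simp add: bounded_bilinear.diff_right[OF bounded_bilinear_matrix_matrix_mult]
            bounded_bilinear.add_right[OF bounded_bilinear_matrix_matrix_mult]
            bounded_bilinear.scaleR_right[OF bounded_bilinear_matrix_matrix_mult] matrix_mul_assoc)
      then show ?thesis
        by (simp add: T_def matrix_inv_left inv) (simp add: trace_def mat_def sum.distrib sum_subtractf sum_divide_distrib)
    qed
    ultimately show ?thesis by simp
  qed
  show ?thesis
  proof
    assume E: "\<forall>y. ?E y"
    have main: "T = 0 \<and> e \<bullet> y + (H *v y) \<bullet> w = 0 \<and> ?N y = Q y * c \<and> a = 0 \<and> (H *v y) \<bullet> b = 0"
      if "y \<noteq> 0" for y
    proof -
      \<comment> \<open>Restriction to the line through \<open>y\<close>: replacing \<open>y\<close>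
        by \<open>t *\<^sub>R y\<close> scales \<open>Q\<close> and \<open>?N\<close> by the square
        of \<open>t\<close> and the linear terms by \<open>t\<close>, which is the shape of the
        one-variable lemma.\<close>
      have "S * T + (S * ((H *v y) \<bullet> w + e \<bullet> y)) * t + (S * (T * Q y + Q y * c - ?N y)) * t\<^sup>2
          = sqrt (1 + Q y * t\<^sup>2) * (a + ((H *v y) \<bullet> b) * t)" for t
        using E[rule_format, of "t *\<^sub>R y"]
        by (simp add: Q_def matrix_vector_mult_scaleR power2_eq_square algebra_simps)
      from quadratic_eq_sqrt_mult_affine_imp_zero[OF _ this] pos[OF that] \<open>S > 0\<close>
      have "T = 0" "(H *v y) \<bullet> w + e \<bullet> y = 0" "T * Q y + Q y * c - ?N y = 0" "a = 0" "(H *v y) \<bullet> b = 0"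
        unfolding Q_def by auto
      then show ?thesis
        by simp
    qed
    \<comment> \<open>There is at least one coordinate, hence a nonzero vector at which the
      conditions on \<open>T\<close> and \<open>a\<close>, which are free of \<open>y\<close>, can
      be read off.\<close>
    have "axis undefined 1 \<noteq> (0 :: real^'m)"
      by (simp add: axis_eq_0_iff)
    then have T: "T = 0" and a: "a = 0"
      using main by blast+
    have N: "?N y = Q y * c" for y
      using main[of y] by (cases "y = 0") (auto simp: Q_def)
    have c: "c = 0"
      using trace[OF N] T by simp
    have "(H *v y) \<bullet> b = 0" for y
      using main[of y] by (cases "y = 0") auto
    \<comment> \<open>At this point \<open>H *v y\<close> is \<open>b\<close> itself, so the product
      is the squared norm of \<open>b\<close>.\<close>
    then have "(H *v (matrix_inv H *v b)) \<bullet> b = 0"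
      by blast
    then have "b = 0"
      by (simp add: matrix_vector_mul_assoc matrix_inv_right inv)
    moreover have "e \<bullet> y + (H *v y) \<bullet> w = 0" for y
      using main[of y] by (cases "y = 0") auto
    ultimately show ?R
      using a c N by simp
  next
    assume R: ?R
    have "T = 0"
      using trace[of 0] R by simp
    have "e \<bullet> y + (H *v y) \<bullet> w = 0" "y \<bullet> (H' *v y) / 2 + (H *v y) \<bullet> (B *v y) = 0" for y
      using R by blast+
    then have "(H *v y) \<bullet> w + e \<bullet> y - y \<bullet> (H' *v y) / 2 - (H *v y) \<bullet> (B *v y) = 0" for y
      by (smt (verit))
    then show "\<forall>y. ?E y"
      using R \<open>T = 0\<close> by simp
  qed
qed

subsection \<open>The Noether identity\<close>

text \<open>Partial derivatives are defined by the one-variable \<open>deriv\<close>. At a point of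
  Frechet differentiability they become values of one linear map, which is the language of the later
  calculations.\<close>

lemma partial_along_eq:
  assumes "(f has_derivative f') (at z)"
  shows "partial_along b f z = f' b"
proof -
  have "((\<lambda>t. z + t *\<^sub>R b) has_derivative (\<lambda>t. t *\<^sub>R b)) (at 0)"
    by (auto intro!: derivative_eq_intros)
  then have "((\<lambda>t. f (z + t *\<^sub>R b)) has_derivative (\<lambda>t. f' (t *\<^sub>R b))) (at 0)"
    by (rule has_derivative_compose) (use assms in simp)
  then have "((\<lambda>t. f (z + t *\<^sub>R b)) has_real_derivative f' b) (at 0)"
    using linear_cmul[OF has_derivative_linear[OF assms]]
    by (simp add: has_field_derivative_def mult_commute_abs)
  then show ?thesis
    unfolding partial_along_def by (rule DERIV_imp_deriv)
qed

text \<open>The derivative is written with \<open>x\<close> in the denominator so that it cancels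
  the factor \<open>det A\<close> of Jacobi's formula.\<close>

lemma has_real_derivative_sqrt_abs:
  assumes "(x::real) \<noteq> 0"
  shows "((\<lambda>x. sqrt \<bar>x\<bar>) has_real_derivative sqrt \<bar>x\<bar> / (2 * x)) (at x)"
proof -
  have "(abs has_real_derivative sgn x) (at x)"
  proof (cases "x > 0")
    case True
    then show ?thesis
      by (intro has_field_derivative_transform_within_open[of "\<lambda>x. x" _ _ "{0<..}" abs])
        (auto intro!: derivative_eq_intros)
  next
    case False
    with assms show ?thesis
      by (intro has_field_derivative_transform_within_open[of "\<lambda>x. - x" _ _ "{..<0}" abs])
        (auto intro!: derivative_eq_intros)
  qed
  then have "((\<lambda>x. sqrt \<bar>x\<bar>) has_real_derivative inverse (sqrt \<bar>x\<bar>) / 2 * sgn x) (at x)"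
    using assms by (intro DERIV_chain2[OF DERIV_real_sqrt]) auto
  moreover have "inverse (sqrt \<bar>x\<bar>) / 2 * sgn x = sqrt \<bar>x\<bar> / (2 * x)"
    using assms by (auto simp: field_simps sgn_if abs_if real_sqrt_mult_self)
  ultimately show ?thesis by metis
qed

lemma quadratic_form_sum:
  fixes A :: "real^'n^'m"
  shows "(\<Sum>i\<in>UNIV. \<Sum>j\<in>UNIV. A $ i $ j * p $ i * q $ j) = p \<bullet> (A *v q)"
  by (simp add: inner_vec_def matrix_vector_mult_def sum_distrib_left ac_simps)

lemma minimal_surface_lagrangian_eq:
  "minimal_surface_lagrangian h lam F =
    (\<lambda>(z, p). sqrt \<bar>det (h z)\<bar> * sqrt (1 + p \<bullet> (matrix_inv (h z) *v p)) + lam * F z)"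
  unfolding minimal_surface_lagrangian_def quadratic_form_sum
  by (simp add: distrib_left flip: real_sqrt_mult)

text \<open>The gradient is parametrized as \<open>p = h z *v y\<close>. Then
  \<open>matrix_inv (h z) *v p = y\<close>, and differentiating the inverse metric produces just the
  form \<open>- (y \<bullet> (h' \<zeta> *v y))\<close>; the inverse survives only in the trace that
  stems from the determinant.\<close>

lemma has_derivative_minimal_surface_lagrangian:
  fixes h :: "(real^'m) \<times> real \<Rightarrow> real^'m^'m"
  assumes h: "(h has_derivative h') (at z)" and F: "(F has_derivative F') (at z)"
    and sym: "transpose (h z) = h z" and inv: "invertible (h z)"
    and pos: "0 < 1 + y \<bullet> (h z *v y)"
  defines "S \<equiv> sqrt \<bar>det (h z)\<bar>" and "W \<equiv> sqrt (1 + y \<bullet> (h z *v y))"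
  shows "(minimal_surface_lagrangian h lam F has_derivative
      (\<lambda>(\<zeta>, \<pi>). S * (trace (matrix_inv (h z) ** h' \<zeta>) / 2 * W
          + (y \<bullet> \<pi> - y \<bullet> (h' \<zeta> *v y) / 2) / W) + lam * F' \<zeta>)) (at (z, h z *v y))"
proof -
  define K p where "K = matrix_inv (h z)" and "p = h z *v y"
  have Kp: "K *v p = y"
    by (simp add: K_def p_def matrix_vector_mul_assoc matrix_inv_left inv)
  have K: "transpose K = K"
    using symmetric_matrix_inv[OF inv sym] by (simp add: K_def)
  have fst: "(fst has_derivative fst) (at (z, p))" and snd: "(snd has_derivative snd) (at (z, p))"
    by (auto intro: derivative_intros)
  have h1: "((\<lambda>w. h (fst w)) has_derivative (\<lambda>v. h' (fst v))) (at (z, p))"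
    using has_derivative_compose[OF fst] h by simp
  have F1: "((\<lambda>w. F (fst w)) has_derivative (\<lambda>v. F' (fst v))) (at (z, p))"
    using has_derivative_compose[OF fst] F by simp
  have "((\<lambda>w. sqrt \<bar>det (h (fst w))\<bar>) has_derivative
      (\<lambda>v. (S / (2 * det (h z))) * (det (h z) * trace (K ** h' (fst v))))) (at (z, p))"
    unfolding S_def K_def
    by (rule has_derivative_compose[OF has_derivative_compose[OF h1] has_field_derivative_imp_has_derivative])
      (use has_derivative_det[OF inv] has_real_derivative_sqrt_abs inv invertible_det_nz in auto)
  then have S1: "((\<lambda>w. sqrt \<bar>det (h (fst w))\<bar>) has_derivative
      (\<lambda>v. S * trace (K ** h' (fst v)) / 2)) (at (z, p))"
    using invertible_det_nz[of "h z"] inv by (simp add: field_simps)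
  have "((\<lambda>w. matrix_inv (h (fst w))) has_derivative (\<lambda>v. - (K ** h' (fst v) ** K))) (at (z, p))"
    unfolding K_def
    using has_derivative_compose[OF h1, of matrix_inv] has_derivative_matrix_inv[OF inv] by simp
  then have "((\<lambda>w. snd w \<bullet> (matrix_inv (h (fst w)) *v snd w)) has_derivative
     (\<lambda>v. snd (z, p) \<bullet> (matrix_inv (h (fst (z, p))) *v snd v + (- (K ** h' (fst v) ** K)) *v snd (z, p))
       + snd v \<bullet> (matrix_inv (h (fst (z, p))) *v snd (z, p)))) (at (z, p))"
    by (intro has_derivative_inner snd bounded_bilinear.FDERIV[OF bounded_bilinear_matrix_vector_mult])
  moreover have "p \<bullet> (K *v \<pi> + (- (K ** M ** K)) *v p) + \<pi> \<bullet> (K *v p)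
      = 2 * (y \<bullet> \<pi>) - y \<bullet> (M *v y)" for \<pi> and M :: "real^'m^'m"
    by (simp add: bounded_bilinear.minus_left[OF bounded_bilinear_matrix_vector_mult] inner_add_right inner_diff_right
           inner_matrix_vector_mult_transpose[of p K] K Kp inner_commute
        flip: matrix_vector_mul_assoc)
  ultimately have "((\<lambda>w. snd w \<bullet> (matrix_inv (h (fst w)) *v snd w)) has_derivative
     (\<lambda>v. 2 * (y \<bullet> snd v) - y \<bullet> (h' (fst v) *v y))) (at (z, p))"
    by (simp add: K_def)
  then have g: "((\<lambda>w. 1 + snd w \<bullet> (matrix_inv (h (fst w)) *v snd w)) has_derivative
     (\<lambda>v. 2 * (y \<bullet> snd v) - y \<bullet> (h' (fst v) *v y))) (at (z, p))"
    by (rule has_derivative_eq_rhs[OF has_derivative_add[OF has_derivative_const]]) simp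
  have W: "1 + snd (z, p) \<bullet> (matrix_inv (h (fst (z, p))) *v snd (z, p)) = 1 + y \<bullet> (h z *v y)"
    using Kp by (simp add: K_def) (simp add: p_def inner_commute)
  then have pos': "0 < 1 + snd (z, p) \<bullet> (matrix_inv (h (fst (z, p))) *v snd (z, p))"
    using pos by simp
  have W1: "((\<lambda>w. sqrt (1 + snd w \<bullet> (matrix_inv (h (fst w)) *v snd w))) has_derivative
     (\<lambda>v. (2 * (y \<bullet> snd v) - y \<bullet> (h' (fst v) *v y)) * (inverse W / 2))) (at (z, p))"
    using DERIV_compose_FDERIV[OF DERIV_real_sqrt[OF pos'] g] by (simp only: W W_def)
  have "(minimal_surface_lagrangian h lam F has_derivative
      (\<lambda>v. S * ((2 * (y \<bullet> snd v) - y \<bullet> (h' (fst v) *v y)) * (inverse W / 2))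
         + S * trace (K ** h' (fst v)) / 2 * W + lam * F' (fst v))) (at (z, p))"
    unfolding minimal_surface_lagrangian_eq case_prod_beta
    using W
    by (intro has_derivative_eq_rhs[OF has_derivative_add[OF has_derivative_mult[OF S1 W1] has_derivative_mult_right[OF F1]]])
      (simp add: S_def W_def)
  then show ?thesis
    unfolding p_def K_def
    by (rule has_derivative_eq_rhs) (auto simp: field_simps)
qed

section \<open>Prolongation and total derivatives in terms of Frechet derivatives\<close>

lemma linear_axis_expansion:
  fixes g :: "real^'n \<Rightarrow> 'b::real_vector"
  assumes "linear g"
  shows "g a = (\<Sum>i\<in>UNIV. a $ i *\<^sub>R g (axis i 1))"
proof -
  have "g a = g (\<Sum>i\<in>UNIV. a $ i *\<^sub>R axis i 1)"
    by (simp add: basis_expansion flip: scalar_mult_eq_scaleR)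
  then show ?thesis
    by (simp add: linear_sum[OF assms] linear_cmul[OF assms])
qed

lemma linear_split:
  assumes "linear (f :: 'a::real_vector \<times> 'b::real_vector \<Rightarrow> 'c::real_vector)"
  shows "linear (\<lambda>a. f (a, 0))" "linear (\<lambda>b. f (0, b))" "f (a, b) = f (a, 0) + f (0, b)"
proof -
  show "f (a, b) = f (a, 0) + f (0, b)"
    using linear_add[OF assms, of "(a, 0)" "(0, b)"] by simp
  show "linear (\<lambda>a. f (a, 0))" 
    by (rule linearI) (use linear_add[OF assms, of "(_, 0)" "(_, 0)"] linear_cmul[OF assms, of _ "(_, 0)"] in simp_all)
  show "linear (\<lambda>b. f (0, b))"
    by (rule linearI) (use linear_add[OF assms, of "(0, _)" "(0, _)"] linear_cmul[OF assms, of _ "(0, _)"] in simp_all)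
qed

lemma px_pu_eq:
  assumes "(f has_derivative f') (at z)"
  shows "px k f z = f' (axis k 1, 0)" "pu f z = f' (0, 1)"
  unfolding px_def pu_def using partial_along_eq[OF assms] by blast+

lemma px_pu_component_eq:
  fixes f :: "(real^'m) \<times> real \<Rightarrow> real^'m"
  assumes "(f has_derivative f') (at z)"
  shows "px k (\<lambda>y. f y $ j) z = f' (axis k 1, 0) $ j" "pu (\<lambda>y. f y $ j) z = f' (0, 1) $ j"
  using px_pu_eq[OF bounded_linear.has_derivative[OF bounded_linear_vec_nth assms]] by blast+

text \<open>The prolonged field acts on \<open>L\<close> as a directional derivative: linearity
  splits \<open>L'\<close> over the three groups of coordinates \<open>x\<close>, \<open>u\<close>
  and \<open>p\<close>, each expanded in its basis.\<close>

lemma first_prolongation_eq: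
  assumes "(L has_derivative L') (at (z, p))"
  shows "first_prolongation \<xi> \<eta> L (z, p) = L' ((\<xi> z, \<eta> z), \<chi> i. prolongation_coeff \<xi> \<eta> i (z, p))"
    (is "_ = L' ((?a, ?b), ?c)")
proof -
  have L': "linear L'"
    by (rule has_derivative_linear[OF assms])
  note lin = linear_split[OF L'] linear_split[OF linear_split(1)[OF L']]
  have "L' ((?a, ?b), ?c) = L' ((?a, 0), 0) + L' ((0, ?b), 0) + L' (0, ?c)"
    using lin(3) lin(6) by metis
  also have "L' ((?a, 0), 0) = (\<Sum>i\<in>UNIV. ?a $ i * L' ((axis i 1, 0), 0))"
    using linear_axis_expansion[OF lin(4), of ?a] by simp
  also have "L' (0, ?c) = (\<Sum>i\<in>UNIV. ?c $ i * L' ((0, 0), axis i 1))"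
    using linear_axis_expansion[OF lin(2), of ?c] by (simp add: zero_prod_def)
  also have "L' ((0, ?b), 0) = ?b * L' ((0, 1), 0)"
    using linear_cmul[OF lin(5), of ?b 1] by simp
  finally show ?thesis
    by (simp add: first_prolongation_def partial_along_eq[OF assms])
qed

text \<open>The contraction with \<open>y\<close> is what the \<open>p\<close>-derivative of the
  Lagrangian calls for. The last term becomes cubic once \<open>p = h z *v y\<close>, and later
  cancels against a part of \<open>L\<close> times the total divergence of \<xi>.\<close>

lemma inner_prolongation_coeff:
  fixes \<xi> :: "(real^'m) \<times> real \<Rightarrow> real^'m"
  assumes \<xi>: "(\<xi> has_derivative \<xi>') (at z)" and \<eta>: "(\<eta> has_derivative \<eta>') (at z)"
  shows "y \<bullet> (\<chi> i. prolongation_coeff \<xi> \<eta> i (z, p)) =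
    \<eta>' (y, 0) + (y \<bullet> p) * \<eta>' (0, 1) - p \<bullet> \<xi>' (y, 0) - (y \<bullet> p) * (p \<bullet> \<xi>' (0, 1))"
proof -
  have coeff: "prolongation_coeff \<xi> \<eta> i (z, p) =
    \<eta>' (axis i 1, 0) + p $ i * \<eta>' (0, 1) - p \<bullet> \<xi>' (axis i 1, 0) - p $ i * (p \<bullet> \<xi>' (0, 1))" for i
    by (simp add: prolongation_coeff_def px_pu_eq[OF \<eta>] px_pu_component_eq[OF \<xi>] inner_vec_def
        sum_distrib_left ac_simps)
  have \<eta>y: "\<eta>' (y, 0) = (\<Sum>i\<in>UNIV. y $ i * \<eta>' (axis i 1, 0))"
    using linear_axis_expansion[OF linear_split(1)[OF has_derivative_linear[OF \<eta>]], of y] by simp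
  have \<xi>y: "\<xi>' (y, 0) = (\<Sum>i\<in>UNIV. y $ i *\<^sub>R \<xi>' (axis i 1, 0))"
    by (rule linear_axis_expansion[OF linear_split(1)[OF has_derivative_linear[OF \<xi>]]])
  have "y \<bullet> (\<chi> i. prolongation_coeff \<xi> \<eta> i (z, p)) =
     (\<Sum>i\<in>UNIV. y $ i * (\<eta>' (axis i 1, 0) + p $ i * \<eta>' (0, 1) - p \<bullet> \<xi>' (axis i 1, 0) - p $ i * (p \<bullet> \<xi>' (0, 1))))"
    by (simp add: inner_vec_def[of y] coeff)
  also have "\<dots> = (\<Sum>i\<in>UNIV. y $ i * \<eta>' (axis i 1, 0)) + (y \<bullet> p) * \<eta>' (0, 1)
      - p \<bullet> (\<Sum>i\<in>UNIV. y $ i *\<^sub>R \<xi>' (axis i 1, 0)) - (y \<bullet> p) * (p \<bullet> \<xi>' (0, 1))"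
    unfolding inner_vec_def[of y p] inner_sum_right sum_distrib_right
    by (simp add: sum.distrib sum_subtractf algebra_simps)
  finally show ?thesis
    by (simp add: \<eta>y \<xi>y)
qed

lemma sum_total_deriv_eq:
  fixes f :: "(real^'m) \<times> real \<Rightarrow> real^'m"
  assumes "(f has_derivative f') (at z)"
  shows "(\<Sum>i\<in>UNIV. total_deriv i (\<lambda>y. f y $ i) (z, p)) = trace (matrix (\<lambda>a. f' (a, 0))) + p \<bullet> f' (0, 1)"
  by (simp add: total_deriv_def px_pu_component_eq[OF assms] sum.distrib trace_def matrix_def inner_vec_def)

text \<open>Since \<open>h z\<close> is invertible, the substitution \<open>p = h z *v y\<close>
  reaches every \<open>p\<close>, and multiplication by the positive root clears the denominator, so
  that the algebraic lemma applies. The bracketed group on the right is the Killing system; the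
  other two equations concern the gauge vector.\<close>

lemma noether_identity_iff:
  fixes h :: "(real^'m) \<times> real \<Rightarrow> real^'m^'m" and lam :: real
  assumes h: "(h has_derivative h') (at z)" and F: "(F has_derivative F') (at z)"
    and \<xi>: "(\<xi> has_derivative \<xi>') (at z)" and \<eta>: "(\<eta> has_derivative \<eta>') (at z)"
    and A: "(A has_derivative A') (at z)"
    and sym: "transpose (h z) = h z" and pos: "\<And>y. y \<noteq> 0 \<Longrightarrow> y \<bullet> (h z *v y) > 0"
  defines "L \<equiv> minimal_surface_lagrangian h lam F" and "B \<equiv> matrix (\<lambda>a. \<xi>' (a, 0))"
  shows "(\<forall>p. first_prolongation \<xi> \<eta> L (z, p)
            + L (z, p) * (\<Sum>i\<in>UNIV. total_deriv i (\<lambda>y. \<xi> y $ i) (z, p))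
          = (\<Sum>i\<in>UNIV. total_deriv i (\<lambda>y. A y $ i) (z, p)))
     \<longleftrightarrow> (\<eta>' (0, 1) = 0 \<and> (\<forall>y. \<eta>' (y, 0) + (h z *v y) \<bullet> \<xi>' (0, 1) = 0)
          \<and> (\<forall>y. y \<bullet> (h' (\<xi> z, \<eta> z) *v y) / 2 + (h z *v y) \<bullet> (B *v y) = 0))
         \<and> trace (matrix (\<lambda>a. A' (a, 0))) = lam * (F' (\<xi> z, \<eta> z) + F z * trace B)
         \<and> A' (0, 1) = (lam * F z) *\<^sub>R \<xi>' (0, 1)"
    (is "(\<forall>p. ?N p) \<longleftrightarrow> ?R")
proof -
  define H S e where "H = h z" and "S = sqrt \<bar>det H\<bar>" and "e = (\<chi> i. \<eta>' (axis i 1, 0))"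
  \<comment> \<open>The differences of the two sides of the gauge equations; they become the
    coefficients of the affine factor beside the root.\<close>
  define a b where "a = trace (matrix (\<lambda>a. A' (a, 0))) - lam * (F' (\<xi> z, \<eta> z) + F z * trace B)"
    and "b = A' (0, 1) - (lam * F z) *\<^sub>R \<xi>' (0, 1)"
  let ?Q = "\<lambda>y. y \<bullet> (H *v y)" and ?H' = "h' (\<xi> z, \<eta> z)" and ?w = "\<xi>' (0, 1)" and ?c = "\<eta>' (0, 1)"
  have inv: "invertible H"
    unfolding H_def using pos by (rule positive_definite_imp_invertible)
  have "S > 0"
    using inv invertible_det_nz[of H] by (simp add: S_def)
  have e: "\<eta>' (y, 0) = e \<bullet> y" for y
    using linear_axis_expansion[OF linear_split(1)[OF has_derivative_linear[OF \<eta>]], of y]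
    by (simp add: e_def inner_vec_def mult.commute)
  have B: "\<xi>' (y, 0) = B *v y" for y
    unfolding B_def using linear_split(1)[OF has_derivative_linear[OF \<xi>]] by (simp add: matrix_works)
  have "?N (H *v y) \<longleftrightarrow>
      S * ((trace (matrix_inv H ** ?H') / 2 + trace B) * (1 + ?Q y) + (H *v y) \<bullet> ?w + e \<bullet> y + ?Q y * ?c
              - y \<bullet> (?H' *v y) / 2 - (H *v y) \<bullet> (B *v y))
            = sqrt (1 + ?Q y) * (a + (H *v y) \<bullet> b)" for y
  proof -
    define p W t \<beta> \<alpha> where "p = H *v y" and "W = sqrt (1 + ?Q y)" and "t = trace (matrix_inv H ** ?H') / 2"
      and "\<beta> = trace B" and "\<alpha> = trace (matrix (\<lambda>a. A' (a, 0)))"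
    \<comment> \<open>The terms that end up divided by \<open>W\<close>: the contribution of the
      prolongation and the variation of the metric inside the root.\<close>
    define n where "n = e \<bullet> y + ?Q y * ?c - p \<bullet> (B *v y) - ?Q y * (p \<bullet> ?w) - y \<bullet> (?H' *v y) / 2"
    have "?Q y \<ge> 0"
      using pos[of y] by (cases "y = 0") (auto simp: H_def)
    then have W: "W > 0" "W * W = 1 + ?Q y"
      by (simp_all add: W_def)
    have L': "(L has_derivative (\<lambda>(\<zeta>, \<pi>). S * (trace (matrix_inv (h z) ** h' \<zeta>) / 2 * W
          + (y \<bullet> \<pi> - y \<bullet> (h' \<zeta> *v y) / 2) / W) + lam * F' \<zeta>)) (at (z, p))"
      using has_derivative_minimal_surface_lagrangian[OF h F sym] inv \<open>?Q y \<ge> 0\<close>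
      unfolding L_def S_def W_def H_def p_def by auto
    have L: "L (z, p) = S * W + lam * F z"
      by (simp add: L_def minimal_surface_lagrangian_eq S_def W_def p_def matrix_vector_mul_assoc
          matrix_inv_left inv inner_commute flip: H_def)
    have "first_prolongation \<xi> \<eta> L (z, p) = S * (t * W + n / W) + lam * F' (\<xi> z, \<eta> z)"
      by (simp add: first_prolongation_eq[OF L'] inner_prolongation_coeff[OF \<xi> \<eta>] n_def t_def e B
          flip: H_def p_def)
    then have "?N p \<longleftrightarrow> S * (t * W + n / W) + lam * F' (\<xi> z, \<eta> z) + (S * W + lam * F z) * (\<beta> + p \<bullet> ?w)
        = \<alpha> + p \<bullet> A' (0, 1)"
      by (simp add: L sum_total_deriv_eq[OF \<xi>] sum_total_deriv_eq[OF A] \<beta>_def B_def \<alpha>_def)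
    also have "\<dots> \<longleftrightarrow> W * (S * (t * W + n / W) + lam * F' (\<xi> z, \<eta> z) + (S * W + lam * F z) * (\<beta> + p \<bullet> ?w))
        = W * (\<alpha> + p \<bullet> A' (0, 1))"
      using W(1) by simp
    also have "W * (S * (t * W + n / W) + lam * F' (\<xi> z, \<eta> z) + (S * W + lam * F z) * (\<beta> + p \<bullet> ?w))
        = S * (t * (W * W) + n + (W * W) * (\<beta> + p \<bullet> ?w)) + W * (lam * F' (\<xi> z, \<eta> z) + lam * F z * (\<beta> + p \<bullet> ?w))"
      using W(1) by (simp add: field_simps)
    also have "\<dots> = W * (\<alpha> + p \<bullet> A' (0, 1)) \<longleftrightarrow>
        S * (t * (W * W) + n + (W * W) * (\<beta> + p \<bullet> ?w)) = W * (a + p \<bullet> b)"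
      by (auto simp: a_def b_def \<alpha>_def \<beta>_def inner_diff_right algebra_simps)
    \<comment> \<open>Substituting \<open>W * W = 1 + ?Q y\<close> cancels the cubic term of
      \<open>n\<close> against the one from the divergence, leaving degree two in
      \<open>y\<close>.\<close>
    also have "t * (W * W) + n + (W * W) * (\<beta> + p \<bullet> ?w) =
       (t + \<beta>) * (1 + ?Q y) + p \<bullet> ?w + e \<bullet> y + ?Q y * ?c - y \<bullet> (?H' *v y) / 2 - p \<bullet> (B *v y)"
      unfolding W(2) n_def by (simp add: algebra_simps)
    finally show ?thesis
      by (simp add: p_def W_def t_def \<beta>_def)
  qed
  note core = this
  have "p = H *v (matrix_inv H *v p)" for p
    by (simp add: matrix_vector_mul_assoc matrix_inv_right inv)
  then have "range ((*v) H) = UNIV"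
    by (intro surjI[of _ "(*v) (matrix_inv H)"]) simp
  then have "(\<forall>p. ?N p) \<longleftrightarrow> (\<forall>p \<in> range ((*v) H). ?N p)"
    by (simp only: ball_UNIV)
  also have "\<dots> \<longleftrightarrow> (\<forall>y. 
      S * ((trace (matrix_inv H ** ?H') / 2 + trace B) * (1 + ?Q y) + (H *v y) \<bullet> ?w + e \<bullet> y + ?Q y * ?c
              - y \<bullet> (?H' *v y) / 2 - (H *v y) \<bullet> (B *v y))
            = sqrt (1 + ?Q y) * (a + (H *v y) \<bullet> b))"
    by (simp only: ball_simps core)
  also have "\<dots> \<longleftrightarrow> ?R"
    using symmetry_determining_equations[of H S ?H' B ?w e ?c a b] sym pos \<open>S > 0\<close>
    by (simp add: H_def e a_def b_def)
  finally show ?thesis .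
qed

subsection \<open>The Killing equations\<close>

lemma line_element_eq: "line_element h z v w = snd v * snd w + fst v \<bullet> (h z *v fst w)"
proof -
  have "(\<Sum>i\<in>UNIV. \<Sum>j\<in>UNIV. h z $ i $ j * fst v $ i * fst w $ j) = fst v \<bullet> (h z *v fst w)"
    by (rule quadratic_form_sum)
  then show ?thesis
    by (simp add: line_element_def)
qed

text \<open>The three conditions are the \<open>uu\<close>, \<open>xu\<close> and \<open>xx\<close>
  components of Killing's equation. The last is kept as a quadratic form to match the Noether side;
  polarization, with the symmetry of \<open>h'\<close>, recovers the bilinear form.\<close>

lemma lie_derivative_line_element_eq_0_iff:
  fixes h :: "(real^'m) \<times> real \<Rightarrow> real^'m^'m"
  assumes h: "(h has_derivative h') (at z)"
    and \<xi>: "(\<xi> has_derivative \<xi>') (at z)" and \<eta>: "(\<eta> has_derivative \<eta>') (at z)"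
    and sym: "transpose (h z) = h z" and sym': "\<And>\<zeta>. transpose (h' \<zeta>) = h' \<zeta>"
  defines "B \<equiv> matrix (\<lambda>a. \<xi>' (a, 0))"
  shows "(\<forall>v w. lie_derivative_metric (\<lambda>z. (\<xi> z, \<eta> z)) (line_element h) z v w = 0)
     \<longleftrightarrow> \<eta>' (0, 1) = 0 \<and> (\<forall>y. \<eta>' (y, 0) + (h z *v y) \<bullet> \<xi>' (0, 1) = 0)
          \<and> (\<forall>y. y \<bullet> (h' (\<xi> z, \<eta> z) *v y) / 2 + (h z *v y) \<bullet> (B *v y) = 0)"
    (is "(\<forall>v w. ?lie v w = 0) \<longleftrightarrow> ?R")
proof -
  define H H' e w c where "H = h z" and "H' = h' (\<xi> z, \<eta> z)" and "e = (\<lambda>y. \<eta>' (y, 0))"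
    and "w = \<xi>' (0, 1)" and "c = \<eta>' (0, 1)"
  have B: "\<xi>' (y, 0) = B *v y" for y
    unfolding B_def using linear_split(1)[OF has_derivative_linear[OF \<xi>]] by (simp add: matrix_works)
  have \<xi>'_eq: "\<xi>' (y, t) = B *v y + t *\<^sub>R w" for y t
    using linear_split(3)[OF has_derivative_linear[OF \<xi>], of y t]
      linear_cmul[OF has_derivative_linear[OF \<xi>], of t "(0, 1)"] B by (simp add: w_def)
  have \<eta>'_eq: "\<eta>' (y, t) = e y + t * c" for y t
    using linear_split(3)[OF has_derivative_linear[OF \<eta>], of y t]
      linear_cmul[OF has_derivative_linear[OF \<eta>], of t "(0, 1)"] by (simp add: e_def c_def)
  have Hsym: "x \<bullet> (H *v y) = (H *v x) \<bullet> y" and H'sym: "x \<bullet> (H' *v y) = y \<bullet> (H' *v x)" for x y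
    using inner_matrix_vector_mult_transpose[of x H y] inner_matrix_vector_mult_transpose[of x H' y] sym sym'
    by (simp_all add: H_def H'_def inner_commute)
  have X: "frechet_derivative (\<lambda>z. (\<xi> z, \<eta> z)) (at z) = (\<lambda>v. (\<xi>' v, \<eta>' v))"
    using frechet_derivative_at[OF has_derivative_Pair[OF \<xi> \<eta>]] by simp
  have g: "frechet_derivative (\<lambda>y. line_element h y v w) (at z) = (\<lambda>\<zeta>. fst v \<bullet> (h' \<zeta> *v fst w))" for v w
  proof -
    have "((\<lambda>y. line_element h y v w) has_derivative (\<lambda>\<zeta>. fst v \<bullet> (h' \<zeta> *v fst w))) (at z)"
      unfolding line_element_eq
      by (intro has_derivative_eq_rhs[OF has_derivative_add[OF has_derivative_const
              has_derivative_inner_right[OF bounded_linear.has_derivative[OF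
                bounded_bilinear.bounded_linear_left[OF bounded_bilinear_matrix_vector_mult] h]]]]) simp
    then show ?thesis
      using frechet_derivative_at by metis
  qed
  have lie: "?lie (x, s) (y, t) = x \<bullet> (H' *v y) + (B *v x) \<bullet> (H *v y) + (H *v x) \<bullet> (B *v y)
       + t * (e x + (H *v x) \<bullet> w) + s * (e y + (H *v y) \<bullet> w) + 2 * s * t * c" for x y s t
    unfolding lie_derivative_metric_def X g unfolding line_element_eq
    by (simp add: \<xi>'_eq \<eta>'_eq Hsym[of x w] Hsym[of x "B *v y"] inner_add_left inner_add_right
        inner_commute[of w] matrix_vector_right_distrib matrix_vector_mult_scaleR algebra_simps flip: H_def H'_def)
  show ?thesis
  proof
    assume L: "\<forall>v w. ?lie v w = 0"
    have [simp]: "e 0 = 0"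
      using linear_0[OF has_derivative_linear[OF \<eta>]] by (simp add: e_def zero_prod_def)
    have "c = 0"
      using L[rule_format, of "(0, 1)" "(0, 1)"] by (simp add: lie)
    moreover have "e y + (H *v y) \<bullet> w = 0" for y
      using L[rule_format, of "(y, 0)" "(0, 1)"] by (simp add: lie)
    moreover have "y \<bullet> (H' *v y) / 2 + (H *v y) \<bullet> (B *v y) = 0" for y
      using L[rule_format, of "(y, 0)" "(y, 0)"] by (simp add: lie inner_commute)
    ultimately show ?R
      by (simp add: H_def H'_def e_def w_def c_def)
  next
    assume R: ?R
    then have E: "e y + (H *v y) \<bullet> w = 0" and Q: "y \<bullet> (H' *v y) / 2 + (H *v y) \<bullet> (B *v y) = 0" for y
      by (simp_all add: e_def H_def H'_def w_def)
    have "x \<bullet> (H' *v y) + (B *v x) \<bullet> (H *v y) + (H *v x) \<bullet> (B *v y) = 0" for x y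
      using Q[of "x + y"] Q[of x] Q[of y] H'sym[of x y]
      by (simp add: matrix_vector_right_distrib inner_add_left inner_add_right inner_commute field_simps)
    then show "\<forall>v w. ?lie v w = 0"
      using R E by (simp add: lie c_def)
  qed
qed

section \<open>Differentiability and symmetry of the metric matrix\<close>

lemma metric_matrix_properties:
  fixes h :: "(real^'m) \<times> real \<Rightarrow> real^'m^'m"
  assumes "open U" and metric: "riemannian_metric_on U (line_element h)" and "z \<in> U"
  shows "h differentiable (at z)" and "transpose (h z) = h z"
    and "\<And>y. y \<noteq> 0 \<Longrightarrow> y \<bullet> (h z *v y) > 0"
proof -
  have entry: "line_element h z (axis i 1, 0) (axis j 1, 0) = h z $ i $ j" for i j z
    by (simp add: line_element_eq inner_axis' matrix_vector_mult_basis column_def)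
  have "(\<lambda>z. line_element h z (axis i 1, 0) (axis j 1, 0)) differentiable (at z)" for i j
    using assms by (auto simp: riemannian_metric_on_def differentiable_on_eq_differentiable_at)
  then show "h differentiable (at z)"
    by (simp add: differentiable_vec_nth_iff entry)
  have "line_element h z (axis i 1, 0) (axis j 1, 0) = line_element h z (axis j 1, 0) (axis i 1, 0)" for i j
    using metric \<open>z \<in> U\<close> unfolding riemannian_metric_on_def by blast
  then show "transpose (h z) = h z"
    by (simp add: entry transpose_def vec_eq_iff)
  show "y \<bullet> (h z *v y) > 0" if "y \<noteq> 0" for y
  proof -
    have "(y, 0) \<noteq> (0 :: (real^'m) \<times> real)"
      using that by (simp add: zero_prod_def)
    then have "line_element h z (y, 0) (y, 0) > 0"
      using metric \<open>z \<in> U\<close> unfolding riemannian_metric_on_def by blast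
    then show ?thesis
      by (simp add: line_element_eq)
  qed
qed

text \<open>Transposition is linear and fixes \<open>h\<close> on an open set, so the transposed
  derivative is again a derivative of \<open>h\<close>, and derivatives are unique.\<close>

lemma symmetric_matrix_has_derivative:
  fixes h :: "'a::real_normed_vector \<Rightarrow> real^'m^'m"
  assumes "(h has_derivative h') (at z)" "open U" "z \<in> U" "\<And>y. y \<in> U \<Longrightarrow> transpose (h y) = h y"
  shows "transpose (h' \<zeta>) = h' \<zeta>"
proof -
  have "bounded_linear (transpose :: real^'m^'m \<Rightarrow> real^'m^'m)"
    by (auto intro!: linear_linear[THEN iffD2] linearI simp: transpose_def vec_eq_iff)
  then have "((\<lambda>y. transpose (h y)) has_derivative (\<lambda>\<zeta>. transpose (h' \<zeta>))) (at z)"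
    by (rule bounded_linear.has_derivative[OF _ assms(1)])
  then have "(h has_derivative (\<lambda>\<zeta>. transpose (h' \<zeta>))) (at z)"
    by (rule has_derivative_transform_within_open) (use assms in auto)
  then show ?thesis
    using has_derivative_unique[OF assms(1)] by metis
qed

subsection \<open>The gauge vector\<close>

lemma has_derivative_along_fibre:
  assumes "(f has_derivative f') (at (x, u))"
  shows "((\<lambda>s. f (x, s)) has_derivative (\<lambda>s. f' (0, s))) (at u)"
  using has_derivative_compose[OF has_derivative_Pair[OF has_derivative_const has_derivative_ident], of f f' x u]
    assms by simp

lemma has_derivative_at_height:
  assumes "(f has_derivative f') (at (x, u))"
  shows "((\<lambda>y. f (y, u)) has_derivative (\<lambda>a. f' (a, 0))) (at x)"
  using has_derivative_compose[OF has_derivative_Pair[OF has_derivative_ident has_derivative_const], of f f' x u]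
    assms by simp

text \<open>\<open>F'\<close> is a derivative in all variables, the antiderivative property one in
  \<open>u\<close> alone; on the fibre through \<open>z\<close> the two must agree by
  uniqueness.\<close>

lemma u_antiderivative_derivative:
  assumes "u_antiderivative U f F" "(F has_derivative F') (at z)" "z \<in> U"
  shows "F' (0, 1) = f z"
proof (cases z)
  case (Pair x u)
  have "((\<lambda>s. F (x, s)) has_derivative (\<lambda>s. F' (0, s))) (at u)"
    using assms(2) has_derivative_along_fibre unfolding Pair by blast
  moreover have "((\<lambda>s. F (x, s)) has_derivative (*) (f (x, u))) (at u)"
    using assms(1,3) unfolding u_antiderivative_def Pair has_field_derivative_def by auto
  ultimately show ?thesis
    using has_derivative_unique[of "\<lambda>s. F (x, s)" "\<lambda>s. F' (0, s)" u] unfolding Pair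
    by (metis mult.right_neutral)
qed

text \<open>The interval assumption makes every fibre convex, so a vanishing
  \<open>u\<close>-derivative forces constancy. The lemma serves both \<eta> and the part of the
  gauge vector that depends on \<open>x\<close> alone.\<close>

lemma constant_on_fibres:
  fixes f :: "'a::euclidean_space \<times> real \<Rightarrow> 'b::euclidean_space"
  assumes "open U" "\<And>x. is_interval {u. (x, u) \<in> U}"
    and "\<And>z. z \<in> U \<Longrightarrow> \<exists>f'. (f has_derivative f') (at z) \<and> f' (0, 1) = 0"
    and "(x, u) \<in> U" "(x, v) \<in> U"
  shows "f (x, u) = f (x, v)"
proof -
  have "((\<lambda>s. f (x, s)) has_derivative (\<lambda>_. 0)) (at s within {u. (x, u) \<in> U})"
    if s: "s \<in> {u. (x, u) \<in> U}" for s
  proof -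
    obtain f' where f': "(f has_derivative f') (at (x, s))" "f' (0, 1) = 0"
      using assms(3)[of "(x, s)"] s by auto
    then have "f' (0, t) = 0" for t
      using linear_cmul[OF has_derivative_linear[OF f'(1)], of t "(0, 1)"] by simp
    then show ?thesis
      using has_derivative_along_fibre[OF f'(1)] by (auto intro: has_derivative_at_withinI)
  qed
  moreover have "convex {u. (x, u) \<in> U}"
    using assms(2) by (simp add: is_interval_convex)
  ultimately have "\<exists>c. \<forall>s\<in>{u. (x, u) \<in> U}. f (x, s) = c"
    by (intro has_derivative_zero_constant)
  then show ?thesis
    using assms(4,5) by auto
qed

text \<open>The existential over \<Phi> is traded for equations on \<open>A\<close> itself.
  \<open>A\<close> minus \<open>lam\<close> times \<open>G\<close> is a function of \<open>x\<close>
  alone exactly when its \<open>u\<close>-derivative vanishes, which is the second equation; the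
  divergence condition on that function is the first.\<close>

lemma prescribed_gauge_iff:
  fixes U :: "((real^'m) \<times> real) set" and A G \<xi> :: "(real^'m) \<times> real \<Rightarrow> real^'m"
  assumes "open U" and intervals: "\<And>x. is_interval {u. (x, u) \<in> U}"
    and F: "u_antiderivative U (\<lambda>z. sqrt \<bar>det (h z)\<bar>) F"
    and \<xi>: "\<xi> differentiable_on U"
    and G: "\<And>k. u_antiderivative U (\<lambda>z. F z * pu (\<lambda>y. \<xi> y $ k) z) (\<lambda>z. G z $ k)"
  defines "D \<equiv> \<lambda>f z. frechet_derivative f (at z)"
  shows "prescribed_gauge U h lam F G \<xi> \<eta> A \<longleftrightarrow> A differentiable_on U \<and>
     (\<forall>z\<in>U. trace (matrix (\<lambda>a. D A z (a, 0)))
          = lam * (frechet_derivative F (at z) (\<xi> z, \<eta> z) + F z * trace (matrix (\<lambda>a. D \<xi> z (a, 0))))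
        \<and> D A z (0, 1) = (lam * F z) *\<^sub>R D \<xi> z (0, 1))"
    (is "_ \<longleftrightarrow> _ \<and> (\<forall>z\<in>U. ?div z \<and> ?u z)")
proof -
  have diff: "f differentiable_on U \<longleftrightarrow> (\<forall>z\<in>U. (f has_derivative frechet_derivative f (at z)) (at z))"
    for f :: "(real^'m) \<times> real \<Rightarrow> 'b::real_normed_vector"
    using \<open>open U\<close> by (simp add: differentiable_on_eq_differentiable_at frechet_derivative_works)
  have openV: "open (fst ` U)"
    using \<open>open U\<close> by (rule open_image_fst)
  have dF: "(F has_derivative frechet_derivative F (at z)) (at z)" if "z \<in> U" for z
    using F that unfolding u_antiderivative_def diff by blast
  have d\<xi>: "(\<xi> has_derivative D \<xi> z) (at z)" if "z \<in> U" for z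
    using \<xi> that unfolding D_def diff by blast
  have "G differentiable_on U"
    using G \<open>open U\<close>
    by (auto simp: u_antiderivative_def differentiable_on_eq_differentiable_at differentiable_vec_nth_iff)
  then have dG: "(G has_derivative D G z) (at z)" if "z \<in> U" for z
    using that unfolding D_def diff by blast
  have Gu: "D G z (0, 1) = F z *\<^sub>R D \<xi> z (0, 1)" if "z \<in> U" for z
  proof -
    have "D G z (0, 1) $ k = F z * D \<xi> z (0, 1) $ k" for k
      using u_antiderivative_derivative[OF G bounded_linear.has_derivative[OF bounded_linear_vec_nth dG[OF that]] that]
        px_pu_component_eq[OF d\<xi>[OF that]] by simp
    then show ?thesis
      by (simp add: vec_eq_iff)
  qed
  \<comment> \<open>As \<open>F\<close> has \<open>u\<close>-derivative
    \<open>sqrt \<bar>det (h z)\<bar>\<close>, the term with \<eta> completes the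
    \<open>x\<close>-part of the derivative of \<open>F\<close> to the derivative along the whole
    field.\<close>
  have rhs: "lam * (\<Sum>k\<in>UNIV. px k (\<lambda>z. \<xi> z $ k * F z) z) + lam * sqrt \<bar>det (h z)\<bar> * \<eta> z
        - lam * (\<Sum>k\<in>UNIV. px k (\<lambda>z. G z $ k) z)
      = lam * (frechet_derivative F (at z) (\<xi> z, \<eta> z) + F z * trace (matrix (\<lambda>a. D \<xi> z (a, 0))))
        - lam * trace (matrix (\<lambda>a. D G z (a, 0)))"
    if "z \<in> U" for z
  proof -
    let ?F' = "frechet_derivative F (at z)"
    have "px k (\<lambda>z. \<xi> z $ k * F z) z = \<xi> z $ k * ?F' (axis k 1, 0) + D \<xi> z (axis k 1, 0) $ k * F z" for k
      by (rule px_pu_eq(1)[OF has_derivative_mult[OF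
            bounded_linear.has_derivative[OF bounded_linear_vec_nth d\<xi>[OF that]] dF[OF that]]])
    moreover have "?F' (\<xi> z, \<eta> z) = (\<Sum>k\<in>UNIV. \<xi> z $ k * ?F' (axis k 1, 0)) + sqrt \<bar>det (h z)\<bar> * \<eta> z"
      using linear_split(3)[OF has_derivative_linear[OF dF[OF that]], of "\<xi> z" "\<eta> z"]
        linear_axis_expansion[OF linear_split(1)[OF has_derivative_linear[OF dF[OF that]]], of "\<xi> z"]
        linear_cmul[OF has_derivative_linear[OF dF[OF that]], of "\<eta> z" "(0, 1)"]
        u_antiderivative_derivative[OF F dF[OF that] that]
      by (simp add: mult.commute)
    ultimately show ?thesis
      by (simp add: px_pu_component_eq[OF dG[OF that]] trace_def matrix_def sum.distrib sum_distrib_left algebra_simps)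
  qed
  have div\<Phi>: "(\<Sum>k\<in>UNIV. partial_along (axis k 1) (\<lambda>y. \<Phi> y $ k) x) = trace (matrix \<Phi>')"
    if "(\<Phi> has_derivative \<Phi>') (at x)" for \<Phi> :: "real^'m \<Rightarrow> real^'m" and \<Phi>' x
    by (simp add: trace_def matrix_def
        partial_along_eq[OF bounded_linear.has_derivative[OF bounded_linear_vec_nth that]])
  have trace_diff: "trace (matrix (\<lambda>a. f (a, 0) - lam *\<^sub>R g (a, 0)))
      = trace (matrix (\<lambda>a. f (a, 0))) - lam * trace (matrix (\<lambda>a. g (a, 0)))"
    for f g :: "(real^'m) \<times> real \<Rightarrow> real^'m"
    by (simp add: trace_def matrix_def sum_subtractf sum_distrib_left)
  show ?thesis
  proof
    assume "prescribed_gauge U h lam F G \<xi> \<eta> A"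
    then obtain \<Phi> where \<Phi>: "\<Phi> differentiable_on (fst ` U)"
      and A\<Phi>: "\<forall>(x, u)\<in>U. \<forall>k. A (x, u) $ k = lam * G (x, u) $ k + \<Phi> x $ k"
      and div\<Phi>': "\<forall>(x, u)\<in>U. (\<Sum>k\<in>UNIV. partial_along (axis k 1) (\<lambda>y. \<Phi> y $ k) x)
         = lam * (\<Sum>k\<in>UNIV. px k (\<lambda>z. \<xi> z $ k * F z) (x, u))
           + lam * sqrt \<bar>det (h (x, u))\<bar> * \<eta> (x, u)
           - lam * (\<Sum>k\<in>UNIV. px k (\<lambda>z. G z $ k) (x, u))"
      unfolding prescribed_gauge_def by blast
    have A: "A z = lam *\<^sub>R G z + \<Phi> (fst z)" if "z \<in> U" for z
      using bspec[OF A\<Phi> that] by (simp add: vec_eq_iff case_prod_beta)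
    have div: "(\<Sum>k\<in>UNIV. partial_along (axis k 1) (\<lambda>y. \<Phi> y $ k) (fst z))
         = lam * (\<Sum>k\<in>UNIV. px k (\<lambda>z. \<xi> z $ k * F z) z) + lam * sqrt \<bar>det (h z)\<bar> * \<eta> z
        - lam * (\<Sum>k\<in>UNIV. px k (\<lambda>z. G z $ k) z)" if "z \<in> U" for z
      using bspec[OF div\<Phi>' that] by (simp only: case_prod_beta prod.collapse)
    have "(A has_derivative D A z) (at z) \<and> ?div z \<and> ?u z" if "z \<in> U" for z
    proof -
      have "\<Phi> differentiable (at (fst z))"
        using \<Phi> imageI[OF that, of fst] unfolding differentiable_on_eq_differentiable_at[OF openV] by (rule bspec)
      then obtain \<Phi>' where \<Phi>': "(\<Phi> has_derivative \<Phi>') (at (fst z))"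
        unfolding differentiable_def by (elim exE)
      have "((\<lambda>z. lam *\<^sub>R G z + \<Phi> (fst z)) has_derivative (\<lambda>v. lam *\<^sub>R D G z v + \<Phi>' (fst v))) (at z)"
        by (intro has_derivative_add has_derivative_scaleR_right dG that
            has_derivative_compose[OF has_derivative_fst[OF has_derivative_ident] \<Phi>'])
      then have "(A has_derivative (\<lambda>v. lam *\<^sub>R D G z v + \<Phi>' (fst v))) (at z)"
        by (rule has_derivative_transform_within_open[OF _ \<open>open U\<close> that]) (simp add: A)
      moreover from this have DA: "D A z = (\<lambda>v. lam *\<^sub>R D G z v + \<Phi>' (fst v))"
        unfolding D_def by (rule frechet_derivative_at[symmetric])
      ultimately have "(A has_derivative D A z) (at z)"
        by simp
      moreover have "trace (matrix \<Phi>') = trace (matrix (\<lambda>a. D A z (a, 0))) - lam * trace (matrix (\<lambda>a. D G z (a, 0)))"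
        using trace_diff[of "D A z" "D G z"] by (simp add: DA)
      then have "?div z"
        using div[OF that] rhs[OF that] div\<Phi>[OF \<Phi>'] by simp
      moreover have "?u z"
        using Gu[OF that] linear_0[OF has_derivative_linear[OF \<Phi>']] by (simp add: DA)
      ultimately show ?thesis
        by blast
    qed
    then show "A differentiable_on U \<and> (\<forall>z\<in>U. ?div z \<and> ?u z)"
      unfolding diff D_def by blast
  next
    assume R: "A differentiable_on U \<and> (\<forall>z\<in>U. ?div z \<and> ?u z)"
    define C where "C = (\<lambda>z. A z - lam *\<^sub>R G z)"
    define \<Phi> where "\<Phi> = (\<lambda>x. C (x, SOME u. (x, u) \<in> U))"
    have dA: "(A has_derivative D A z) (at z)" if "z \<in> U" for z
      using R that unfolding diff D_def by blast
    have dC: "(C has_derivative (\<lambda>v. D A z v - lam *\<^sub>R D G z v)) (at z)" if "z \<in> U" for z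
      unfolding C_def by (intro has_derivative_diff has_derivative_scaleR_right dA dG that)
    have C: "C (x, u) = \<Phi> x" if "(x, u) \<in> U" for x u
      unfolding \<Phi>_def
    proof (rule constant_on_fibres[OF \<open>open U\<close> intervals _ that])
      show "(x, SOME u. (x, u) \<in> U) \<in> U"
        using that by (rule someI)
      show "\<exists>C'. (C has_derivative C') (at z) \<and> C' (0, 1) = 0" if "z \<in> U" for z
        using dC[OF that] Gu[OF that] R that by (intro exI[of _ "\<lambda>v. D A z v - lam *\<^sub>R D G z v"]) auto
    qed
    \<comment> \<open>The chosen height may jump with \<open>x\<close>. Near \<open>x\<close>,
      therefore, \<Phi> is compared with \<open>C\<close> on the slice at the fixed height
      \<open>u\<close>, which meets \<open>U\<close> in an open set.\<close>
    have d\<Phi>: "(\<Phi> has_derivative (\<lambda>a. D A (x, u) (a, 0) - lam *\<^sub>R D G (x, u) (a, 0))) (at x)"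
      if "(x, u) \<in> U" for x u
    proof (rule has_derivative_transform_within_open[OF has_derivative_at_height[OF dC[OF that]]])
      show "open {y. (y, u) \<in> U}"
        using open_vimage[OF \<open>open U\<close>, of "\<lambda>y. (y, u)"] by (simp add: vimage_def continuous_intros)
    qed (use that C in auto)
    have "\<Phi> differentiable_on (fst ` U)"
      unfolding differentiable_on_eq_differentiable_at[OF openV] differentiable_def using d\<Phi> by force
    moreover have "A (x, u) $ k = lam * G (x, u) $ k + \<Phi> x $ k" if "(x, u) \<in> U" for x u k
      by (simp add: C[OF that, symmetric] C_def)
    moreover have "(\<Sum>k\<in>UNIV. partial_along (axis k 1) (\<lambda>y. \<Phi> y $ k) x)
        = lam * (\<Sum>k\<in>UNIV. px k (\<lambda>z. \<xi> z $ k * F z) (x, u)) + lam * sqrt \<bar>det (h (x, u))\<bar> * \<eta> (x, u)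
        - lam * (\<Sum>k\<in>UNIV. px k (\<lambda>z. G z $ k) (x, u))" if "(x, u) \<in> U" for x u
      unfolding rhs[OF that] div\<Phi>[OF d\<Phi>[OF that]] trace_diff using R that by simp
    ultimately show "prescribed_gauge U h lam F G \<xi> \<eta> A"
      unfolding prescribed_gauge_def by blast
  qed
qed



text \<open>The substance is the second conjunct, which characterizes each gauge vector
  individually; the first follows by quantifying over \<open>A\<close>. That \<eta> depends on
  \<open>x\<close> alone comes from the \<open>uu\<close> component of Killing's equation.\<close>

theorem theorem2:
  fixes U :: "((real ^ 'm::finite) \<times> real) set"
    and h :: "(real ^ 'm) \<times> real \<Rightarrow> real ^ 'm ^ 'm"
    and lam :: real
    and F :: "(real ^ 'm) \<times> real \<Rightarrow> real"
    and \<xi> :: "(real ^ 'm) \<times> real \<Rightarrow> real ^ 'm"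
    and \<eta> :: "(real ^ 'm) \<times> real \<Rightarrow> real"
    and G :: "(real ^ 'm) \<times> real \<Rightarrow> real ^ 'm"
  assumes "open U"
    and "\<And>x. is_interval {u. (x, u) \<in> U}"
    and "riemannian_metric_on U (line_element h)"
    and "u_antiderivative U (\<lambda>z. sqrt \<bar>det (h z)\<bar>) F"
    and "\<xi> differentiable_on U"
    and "\<eta> differentiable_on U"
    and "\<And>k. u_antiderivative U (\<lambda>z. F z * pu (\<lambda>y. \<xi> y $ k) z) (\<lambda>z. G z $ k)"
  shows "(noether_point_symmetry U (minimal_surface_lagrangian h lam F) \<xi> \<eta> \<longleftrightarrow>
            killing_vector_field U (line_element h) (\<lambda>z. (\<xi> z, \<eta> z)) \<and>
            (\<exists>\<eta>0 :: real ^ 'm \<Rightarrow> real. \<forall>(x, u)\<in>U. \<eta> (x, u) = \<eta>0 x) \<and>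
            (\<exists>A. prescribed_gauge U h lam F G \<xi> \<eta> A)) \<and>
         (\<forall>A. noether_gauge_vector U (minimal_surface_lagrangian h lam F) \<xi> \<eta> A \<longleftrightarrow>
            killing_vector_field U (line_element h) (\<lambda>z. (\<xi> z, \<eta> z)) \<and>
            (\<exists>\<eta>0 :: real ^ 'm \<Rightarrow> real. \<forall>(x, u)\<in>U. \<eta> (x, u) = \<eta>0 x) \<and>
            prescribed_gauge U h lam F G \<xi> \<eta> A)"
proof -
  note U = assms(1) and intervals = assms(2) and metric = assms(3) and F = assms(4) and G = assms(7)
  define D where "D = (\<lambda>(f :: (real^'m) \<times> real \<Rightarrow> real^'m) z. frechet_derivative f (at z))"
  define \<eta>' h' where "\<eta>' = (\<lambda>z. frechet_derivative \<eta> (at z))" and "h' = (\<lambda>z. frechet_derivative h (at z))"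
  note works = differentiable_on_eq_differentiable_at[OF U] frechet_derivative_works
  have d\<xi>: "(\<xi> has_derivative D \<xi> z) (at z)" and d\<eta>: "(\<eta> has_derivative \<eta>' z) (at z)"
    and dF: "(F has_derivative frechet_derivative F (at z)) (at z)"
    and dh: "(h has_derivative h' z) (at z)" if "z \<in> U" for z
    using assms(5,6) F metric_matrix_properties(1)[OF U metric] that
    by (auto simp: D_def \<eta>'_def h'_def u_antiderivative_def works)
  note h_sym = metric_matrix_properties(2)[OF U metric] and h_pos = metric_matrix_properties(3)[OF U metric]
  have h'_sym: "transpose (h' z \<zeta>) = h' z \<zeta>" if "z \<in> U" for z \<zeta>
    using symmetric_matrix_has_derivative[OF dh[OF that] U that h_sym] .
  \<comment> \<open>The Killing system at a point; \<open>?G\<close> below is the pair of gauge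
    equations. Killing fields, prescribed gauges and Noether gauge vectors are each translated into
    these two predicates.\<close>
  let ?K = "\<lambda>z. \<eta>' z (0, 1) = 0 \<and> (\<forall>y. \<eta>' z (y, 0) + (h z *v y) \<bullet> D \<xi> z (0, 1) = 0)
          \<and> (\<forall>y. y \<bullet> (h' z (\<xi> z, \<eta> z) *v y) / 2 + (h z *v y) \<bullet> (matrix (\<lambda>a. D \<xi> z (a, 0)) *v y) = 0)"
  let ?G = "\<lambda>A z. trace (matrix (\<lambda>a. D A z (a, 0)))
          = lam * (frechet_derivative F (at z) (\<xi> z, \<eta> z) + F z * trace (matrix (\<lambda>a. D \<xi> z (a, 0))))
        \<and> D A z (0, 1) = (lam * F z) *\<^sub>R D \<xi> z (0, 1)"
  have "(\<lambda>z. (\<xi> z, \<eta> z)) differentiable_on U"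
    using has_derivative_Pair[OF d\<xi> d\<eta>]
    by (auto simp: differentiable_on_eq_differentiable_at[OF U] differentiable_def)
  then have killing: "killing_vector_field U (line_element h) (\<lambda>z. (\<xi> z, \<eta> z)) \<longleftrightarrow> (\<forall>z\<in>U. ?K z)"
    unfolding killing_vector_field_def
    using lie_derivative_line_element_eq_0_iff[OF dh d\<xi> d\<eta> h_sym h'_sym] by simp
  have fibre: "\<exists>\<eta>0. \<forall>(x, u)\<in>U. \<eta> (x, u) = \<eta>0 x" if K: "\<forall>z\<in>U. ?K z"
  proof -
    have "\<eta> (x, u) = \<eta> (x, SOME u. (x, u) \<in> U)" if "(x, u) \<in> U" for x u
    proof (rule constant_on_fibres[OF U intervals _ that])
      show "(x, SOME u. (x, u) \<in> U) \<in> U"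
        using that by (rule someI)
      show "\<exists>f'. (\<eta> has_derivative f') (at z) \<and> f' (0, 1) = 0" if "z \<in> U" for z
        using d\<eta>[OF that] K that by blast
    qed
    then show ?thesis
      by (intro exI[of _ "\<lambda>x. \<eta> (x, SOME u. (x, u) \<in> U)"]) auto
  qed
  have gauge: "prescribed_gauge U h lam F G \<xi> \<eta> A \<longleftrightarrow> A differentiable_on U \<and> (\<forall>z\<in>U. ?G A z)" for A
    unfolding D_def by (rule prescribed_gauge_iff[OF U intervals F assms(5) G])
  have noether: "noether_gauge_vector U (minimal_surface_lagrangian h lam F) \<xi> \<eta> A \<longleftrightarrow>
      A differentiable_on U \<and> (\<forall>z\<in>U. ?K z \<and> ?G A z)" for A
  proof (cases "A differentiable_on U")
    case True
    then have dA: "(A has_derivative D A z) (at z)" if "z \<in> U" for z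
      using that by (auto simp: D_def works)
    show ?thesis
      unfolding noether_gauge_vector_def
      using True noether_identity_iff[OF dh dF d\<xi> d\<eta> dA h_sym h_pos] by simp
  qed (simp add: noether_gauge_vector_def)
  have "noether_gauge_vector U (minimal_surface_lagrangian h lam F) \<xi> \<eta> A \<longleftrightarrow>
            killing_vector_field U (line_element h) (\<lambda>z. (\<xi> z, \<eta> z)) \<and>
            (\<exists>\<eta>0 :: real ^ 'm \<Rightarrow> real. \<forall>(x, u)\<in>U. \<eta> (x, u) = \<eta>0 x) \<and>
            prescribed_gauge U h lam F G \<xi> \<eta> A" for A
    unfolding noether killing gauge using fibre by blast
  then show ?thesis
    unfolding noether_point_symmetry_def by blast
qed

end
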